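(* For every function $f:\mathbb N\to\mathbb R$ with $f(q)\to\infty$, there exists a totally ergodic rank-one transformation on a probability space whose associated subshift has complexity $p$ satisfying $p(q)<1.5q+f(q)$ for all sufficiently large $q$, and $p(h_n)<h_n+f(h_n)$ for all $n\ge 2$, where $h_n$ is the height of the $n$-th column (the length of $B_n$).
   Context: Rank-one transformations: a rank-one transformation $T$ is specified by a cut sequence $(r_n)_{n\ge1}$ of positive integers and a spacer sequence $(s_{n,i})_{n\ge 1,\,0\le i\le r_n}$ of nonnegative integers via cutting and stacking ($C_1=[0,1)$; $C_{n+1}$ is obtained by cutting $C_n$ into $r_n+1$ equal-width subcolumns, adding $s_{n,i}$ spacers atop subcolumn $i$, and stacking left to right). The associated subshift $X(T)\subseteq\{0,1\}^{\mathbb Z}$ is given by $B_1=0$, $B_{n+1}=B_n1^{s_{n,0}}\cdots B_n1^{s_{n,r_n}}$, $h_n=$ length of $B_n$: it is the set of biinfinite sequences all of whose finite subwords are subwords of some $B_n$; $p(q)$ is the number of distinct words of length $q$ occurring in $X(T)$. Totally ergodic: $T^k$ is ergodic for every $k\ge1$. *)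

theory Defs
  imports "HOL-Probability.Probability" "HOL-Library.Sublist"
begin

text \<open>Rank-one transformation given by cut sequence r (r n = r_n, n >= 1) and
spacer sequence s (s n i = s_{n,i}, n >= 1, 0 <= i <= r n).  Index 0 is unused.\<close>

fun Bw :: "(nat \<Rightarrow> nat) \<Rightarrow> (nat \<Rightarrow> nat \<Rightarrow> nat) \<Rightarrow> nat \<Rightarrow> nat list" where
  "Bw r s 0 = [0]"
| "Bw r s (Suc 0) = [0]"
| "Bw r s (Suc (Suc m)) =
     concat (map (\<lambda>i. Bw r s (Suc m) @ replicate (s (Suc m) i) 1) [0..<r (Suc m) + 1])"

definition hgt :: "(nat \<Rightarrow> nat) \<Rightarrow> (nat \<Rightarrow> nat \<Rightarrow> nat) \<Rightarrow> nat \<Rightarrow> nat" where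
  "hgt r s n = length (Bw r s n)"

definition wid :: "(nat \<Rightarrow> nat) \<Rightarrow> nat \<Rightarrow> real" where
  "wid r n = 1 / (\<Prod>k\<in>{1..<n}. real (r k + 1))"

text \<open>C_n is a tower of disjoint intervals exactly covering [0, Lend n); spacers added at
stage n are placed to the right of [0, Lend n).\<close>
fun Lend :: "(nat \<Rightarrow> nat) \<Rightarrow> (nat \<Rightarrow> nat \<Rightarrow> nat) \<Rightarrow> nat \<Rightarrow> real" where
  "Lend r s 0 = 1"
| "Lend r s (Suc 0) = 1"
| "Lend r s (Suc (Suc m)) =
     Lend r s (Suc m) + real (\<Sum>i\<le>r (Suc m). s (Suc m) i) * wid r (Suc (Suc m))"

text \<open>Left endpoints of the levels of C_n, bottom to top; level j is
[lev n ! j, lev n ! j + wid n).\<close>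
fun lev :: "(nat \<Rightarrow> nat) \<Rightarrow> (nat \<Rightarrow> nat \<Rightarrow> nat) \<Rightarrow> nat \<Rightarrow> real list" where
  "lev r s 0 = [0]"
| "lev r s (Suc 0) = [0]"
| "lev r s (Suc (Suc m)) =
     concat (map (\<lambda>i.
        map (\<lambda>a. a + real i * wid r (Suc (Suc m))) (lev r s (Suc m))
        @ map (\<lambda>k. Lend r s (Suc m) + real ((\<Sum>i'<i. s (Suc m) i') + k) * wid r (Suc (Suc m)))
              [0..<s (Suc m) i])
      [0..<r (Suc m) + 1])"

definition in_nontop_level :: "(nat \<Rightarrow> nat) \<Rightarrow> (nat \<Rightarrow> nat \<Rightarrow> nat) \<Rightarrow> nat \<Rightarrow> nat \<Rightarrow> real \<Rightarrow> bool" where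
  "in_nontop_level r s n j x \<longleftrightarrow> 1 \<le> n \<and> Suc j < length (lev r s n) \<and>
     lev r s n ! j \<le> x \<and> x < lev r s n ! j + wid r n"

text \<open>The underlying space (union of all columns) and the transformation: on a non-top level
of some C_n, T translates the level onto the next one. (Elsewhere -- a null set -- identity.)\<close>
definition rspace :: "(nat \<Rightarrow> nat) \<Rightarrow> (nat \<Rightarrow> nat \<Rightarrow> nat) \<Rightarrow> real set" where
  "rspace r s = (\<Union>n. {0..<Lend r s n})"

definition Tmap :: "(nat \<Rightarrow> nat) \<Rightarrow> (nat \<Rightarrow> nat \<Rightarrow> nat) \<Rightarrow> real \<Rightarrow> real" where
  "Tmap r s x = (if \<exists>n j. in_nontop_level r s n j x
     then (SOME y. \<exists>n j. in_nontop_level r s n j x \<and> y = x - lev r s n ! j + lev r s n ! Suc j)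
     else x)"

text \<open>Normalised Lebesgue measure on the space (a probability space when the space has
finite Lebesgue measure).\<close>
definition rmeas :: "(nat \<Rightarrow> nat) \<Rightarrow> (nat \<Rightarrow> nat \<Rightarrow> nat) \<Rightarrow> real measure" where
  "rmeas r s = uniform_measure lborel (rspace r s)"

definition measure_preserving_map :: "'a measure \<Rightarrow> ('a \<Rightarrow> 'a) \<Rightarrow> bool" where
  "measure_preserving_map M f \<longleftrightarrow> f \<in> measurable M M \<and>
     (\<forall>A\<in>sets M. emeasure M (f -` A \<inter> space M) = emeasure M A)"

definition ergodic_map :: "'a measure \<Rightarrow> ('a \<Rightarrow> 'a) \<Rightarrow> bool" where
  "ergodic_map M f \<longleftrightarrow> measure_preserving_map M f \<and>
     (\<forall>A\<in>sets M. f -` A \<inter> space M = A \<longrightarrow> emeasure M A = 0 \<or> emeasure M (space M - A) = 0)"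

definition totally_ergodic :: "'a measure \<Rightarrow> ('a \<Rightarrow> 'a) \<Rightarrow> bool" where
  "totally_ergodic M f \<longleftrightarrow> (\<forall>k::nat. k \<ge> 1 \<longrightarrow> ergodic_map M (f ^^ k))"

definition subshift :: "(nat \<Rightarrow> nat) \<Rightarrow> (nat \<Rightarrow> nat \<Rightarrow> nat) \<Rightarrow> (int \<Rightarrow> nat) set" where
  "subshift r s = {x. \<forall>(i::int) (m::nat). \<exists>n\<ge>1.
      sublist (map (\<lambda>j. x (i + int j)) [0..<m]) (Bw r s n)}"

definition complexity :: "(nat \<Rightarrow> nat) \<Rightarrow> (nat \<Rightarrow> nat \<Rightarrow> nat) \<Rightarrow> nat \<Rightarrow> nat" where
  "complexity r s q = card {w. \<exists>x\<in>subshift r s. \<exists>i::int. w = map (\<lambda>j. x (i + int j)) [0..<q]}"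

end

theory Submission
  imports Defs
begin

text \<open>The spacers alternate between two patterns: with \<open>g\<^sub>n = 0\<close> for odd \<open>n\<close> and \<open>g\<^sub>n = 1\<close> for even \<open>n\<close>,
  the word \<open>B\<^sub>n\<^sub>+\<^sub>1\<close> consists of \<open>r\<^sub>n + 1\<close> copies of \<open>B\<^sub>n\<close> separated by \<open>1\<close> to the power \<open>g\<^sub>n\<close>. A word of length
  \<open>q \<le> h\<^sub>n\<^sub>+\<^sub>1\<close> lies in \<open>B\<^sub>n\<^sub>+\<^sub>1 B\<^sub>n\<^sub>+\<^sub>1\<close> or \<open>B\<^sub>n\<^sub>+\<^sub>1 1 B\<^sub>n\<^sub>+\<^sub>1\<close>: either it follows the periodic pattern of level \<open>n\<close>
  (at most \<open>h\<^sub>n + g\<^sub>n\<close> words), or it is determined by the position of the one gap breaking that pattern.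
  This gives \<open>p(q) \<le> q + h\<^sub>n\<close>. If \<open>h\<^sub>n < q \<le> 2 h\<^sub>n\<close>, the words with at most \<open>h\<^sub>n\<close> letters on either side
  of the gap follow the periodic pattern of level \<open>n - 1\<close>, whence \<open>p(q) < 2 q - h\<^sub>n + h\<^sub>n\<^sub>-\<^sub>1\<close>. Both bounds
  suffice once \<open>f(q) > h\<^sub>n\<^sub>-\<^sub>1\<close> for all \<open>q \<ge> h\<^sub>n\<close>, which is arranged by taking \<open>r\<^sub>n\<^sub>-\<^sub>1\<close> large.

  For total ergodicity, choose \<open>r\<^sub>n + 1\<close> divisible by \<open>n!\<close>. Given \<open>k\<close> and a large even \<open>n\<close>, \<open>k\<close> divides \<open>h\<^sub>n\<close>
  and \<open>r\<^sub>n + 1\<close>, so the copies of a level of column \<open>n\<close> in column \<open>n + 1\<close> are spaced by \<open>h\<^sub>n + 1\<close> and are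
  equidistributed modulo \<open>k\<close>. Hence a set invariant under the \<open>k\<close>-th power has the same density in all
  levels of column \<open>n\<close>; since the widths tend to \<open>0\<close>, its density is constant on all intervals.\<close>

section \<open>Factors of periodic words and of two words joined by a gap\<close>

lemma nth_concat_replicate:
  assumes "t < k * length P"
  shows "concat (replicate k P) ! t = P ! (t mod length P)"
  using assms
proof (induction k arbitrary: t)
  case (Suc k)
  show ?case
  proof (cases "t < length P")
    case False
    then have "concat (replicate k P) ! (t - length P) = P ! ((t - length P) mod length P)"
      using Suc.prems by (intro Suc.IH) auto
    with False show ?thesis by (simp add: nth_append le_mod_geq)
  qed (simp add: nth_append)
qed simp

lemma sublist_periodic:
  assumes "sublist w (concat (replicate k P))" "P \<noteq> []"
  shows "\<exists>i<length P. w = map (\<lambda>j. P ! ((i + j) mod length P)) [0..<length w]"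
proof -
  obtain us vs where eq: "concat (replicate k P) = us @ w @ vs"
    using assms(1) by (auto simp: sublist_def)
  have len: "length us + length w \<le> k * length P"
    using arg_cong[OF eq, of length] by (simp add: length_concat sum_list_replicate)
  have "w = map (\<lambda>j. P ! ((length us mod length P + j) mod length P)) [0..<length w]"
  proof (rule nth_equalityI)
    fix j assume j: "j < length w"
    have "w ! j = concat (replicate k P) ! (length us + j)"
      using j by (simp add: eq nth_append)
    also have "\<dots> = P ! ((length us + j) mod length P)"
      using j len by (intro nth_concat_replicate) simp
    finally show "w ! j = map (\<lambda>j. P ! ((length us mod length P + j) mod length P)) [0..<length w] ! j"
      using j by (simp add: mod_add_left_eq)
  qed simp
  then show ?thesis using assms(2) by (intro exI[of _ "length us mod length P"]) auto
qed

definition periodic_words :: "nat \<Rightarrow> 'a list \<Rightarrow> 'a list set" where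
  "periodic_words q P = {w. length w = q \<and> (\<exists>k. sublist w (concat (replicate k P)))}"

text \<open>A factor of a power of \<open>P\<close> is fixed by its length and by its starting
  position modulo \<open>length P\<close>.\<close>

lemma card_periodic_words:
  assumes "P \<noteq> []"
  shows "finite (periodic_words q P)" "card (periodic_words q P) \<le> length P"
proof -
  have sub: "periodic_words q P \<subseteq> (\<lambda>i. map (\<lambda>j. P ! ((i + j) mod length P)) [0..<q]) ` {..<length P}"
    using sublist_periodic[OF _ assms] by (force simp: periodic_words_def)
  show "finite (periodic_words q P)" by (rule finite_subset[OF sub]) simp
  show "card (periodic_words q P) \<le> length P"
    using surj_card_le[OF _ sub] by simp
qed

text \<open>The bounds on \<open>length u\<close> normalise the straddling case. For
  \<open>g = 0\<close> they force both pieces to be non-empty; for \<open>g = 1\<close> either piece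
  may be empty, because the spacer itself belongs to \<open>w\<close>. The number of split points
  left over is what the counting arguments use.\<close>

lemma sublist_around_gap:
  assumes "sublist w (X @ replicate g a @ Y)" "g \<le> 1"
  shows "sublist w X \<or> sublist w Y \<or>
    (\<exists>u v. w = u @ replicate g a @ v \<and> suffix u X \<and> prefix v Y \<and> 1 - g \<le> length u \<and> length u < length w)"
proof (cases "g = 0")
  case True
  with assms(1) consider "sublist w X" | "sublist w Y"
    | u v where "w = u @ v" "suffix u X" "prefix v Y"
    by (auto simp: sublist_append)
  then show ?thesis
  proof cases
    case 3
    show ?thesis
    proof (cases "u = [] \<or> v = []")
      case True
      with 3 show ?thesis by (auto simp: prefix_imp_sublist suffix_imp_sublist)
    next
      case False
      with 3 True show ?thesis 
        by (intro disjI2 exI[of _ u] exI[of _ v]) (auto simp: Suc_le_eq)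
    qed
  qed auto
next
  case False
  with assms have g: "g = 1" by simp
  from assms(1) consider "sublist w X" | "sublist w (a # Y)"
    | u v where "w = u @ v" "suffix u X" "prefix v (a # Y)"
    by (auto simp: sublist_append g)
  then show ?thesis
  proof cases
    case 2
    then consider "sublist w Y" | "prefix w (a # Y)" by (auto simp: sublist_Cons_right)
    then show ?thesis
    proof cases
      case 2
      show ?thesis
      proof (cases w)
        case (Cons b w')
        with 2 have "w = [] @ replicate g a @ w'" "prefix w' Y" by (auto simp: g)
        then show ?thesis
          by (intro disjI2 exI[of _ "[]"] exI[of _ w']) (auto simp: g)
      qed simp
    qed simp
  next
    case 3
    then show ?thesis
    proof (cases v)
      case Nil
      with 3 show ?thesis by (auto simp: suffix_imp_sublist)
    next
      case (Cons b v')
      with 3 show ?thesis 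
        by (intro disjI2 exI[of _ u] exI[of _ v']) (auto simp: g)
    qed
  qed simp
qed

lemma sublist_glue:
  assumes "suffix u X" "prefix v Y"
  shows "sublist (u @ m @ v) (X @ m @ Y)"
proof -
  obtain us vs where "X = us @ u" "Y = v @ vs" using assms by (auto simp: suffix_def prefix_def)
  then show ?thesis by (simp add: sublist_def, metis append_assoc)
qed

text \<open>Copies are peeled off from the left. A word straddling the first gap has at most
  \<open>length B\<close> letters beyond it, so its right piece is a prefix of the next copy and the
  word already fits into two copies.\<close>

lemma sublist_tower:
  assumes "sublist w (concat (replicate k (B @ replicate g a)) @ B)" "length w \<le> length B" "g \<le> 1"
  shows "sublist w (B @ replicate g a @ B)"
  using assms(1)
proof (induction k)
  case (Suc k)
  let ?R = "concat (replicate k (B @ replicate g a)) @ B"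
  have "prefix B ?R" by (cases k) auto
  from Suc.prems have "sublist w (B @ replicate g a @ ?R)" by simp
  from sublist_around_gap[OF this assms(3)] show ?case
  proof (elim disjE exE conjE)
    fix u v assume w: "w = u @ replicate g a @ v" and u: "suffix u B" and v: "prefix v ?R"
    from w assms(2) have "length v \<le> length B" by simp
    with v \<open>prefix B ?R\<close> have "prefix v B" by (rule prefix_length_prefix)
    with u show ?thesis by (simp add: w sublist_glue)
  qed (auto intro: Suc.IH sublist_order.order_trans[of w B])
qed (simp add: sublist_append)

section \<open>Counting the words of the alternating construction\<close>

definition lang :: "(nat \<Rightarrow> nat) \<Rightarrow> (nat \<Rightarrow> nat \<Rightarrow> nat) \<Rightarrow> nat \<Rightarrow> nat list set" where
  "lang r s q = {w. length w = q \<and> (\<exists>n\<ge>1. sublist w (Bw r s n))}"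

text \<open>Every word seen in the subshift is a factor of some block, so \<open>lang\<close> bounds
  the complexity from above. Finiteness matters because \<open>card\<close> of an infinite set is
  0.\<close>

lemma complexity_le_card_lang:
  assumes "finite (lang r s q)"
  shows "complexity r s q \<le> card (lang r s q)"
  unfolding complexity_def
  by (rule card_mono[OF assms]) (auto simp: lang_def subshift_def)

definition gap :: "nat \<Rightarrow> nat" where
  "gap n = (if even n then 1 else 0)"

text \<open>The last subcolumn receives no spacer, so each block begins and ends with the previous
  one. Since \<open>gap\<close> alternates, the value that breaks the pattern of one level is the
  regular value of the level below.\<close>

definition alt_spacers :: "(nat \<Rightarrow> nat) \<Rightarrow> nat \<Rightarrow> nat \<Rightarrow> nat" where
  "alt_spacers r n i = (if i < r n then gap n else 0)"

lemma gap_le_1: "gap n \<le> 1" and gap_Suc: "gap (Suc n) = 1 - gap n"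
  by (auto simp: gap_def)

locale alternating =
  fixes r :: "nat \<Rightarrow> nat"
  assumes r_pos: "n \<ge> 1 \<Longrightarrow> r n \<ge> 1"
begin

abbreviation B where "B \<equiv> Bw r (alt_spacers r)"
abbreviation h where "h \<equiv> hgt r (alt_spacers r)"
abbreviation P where "P n \<equiv> B n @ replicate (gap n) 1"

lemma B_Suc:
  assumes "n \<ge> 1"
  shows "B (Suc n) = concat (replicate (r n) (P n)) @ B n"
proof -
  obtain m where n: "n = Suc m" using assms by (cases n) auto
  have "map (\<lambda>i. B n @ replicate (alt_spacers r n i) 1) [0..<r n] = map (\<lambda>i. P n) [0..<r n]"
    by (rule map_cong) (auto simp: alt_spacers_def)
  then show ?thesis by (simp add: n alt_spacers_def map_replicate_const)
qed

lemma h_1: "h (Suc 0) = 1"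
  by (simp add: hgt_def)

lemma h_Suc: "n \<ge> 1 \<Longrightarrow> h (Suc n) = (r n + 1) * h n + r n * gap n"
  by (simp add: hgt_def B_Suc length_concat sum_list_replicate algebra_simps)

lemma h_pos: "n \<ge> 1 \<Longrightarrow> h n \<ge> 1"
  by (induction n rule: dec_induct) (auto simp: h_1 h_Suc)

lemma h_double: "n \<ge> 1 \<Longrightarrow> 2 * h n \<le> h (Suc n)"
  using r_pos[of n] by (cases "r n") (auto simp: h_Suc)

lemma B_prefix_suffix_Suc: "n \<ge> 1 \<Longrightarrow> prefix (B n) (B (Suc n)) \<and> suffix (B n) (B (Suc n))"
  using B_Suc[of n] by (cases "r n") (auto simp: suffix_def)

lemma B_prefix_suffix:
  assumes "1 \<le> n" "n \<le> m"
  shows "prefix (B n) (B m) \<and> suffix (B n) (B m)"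
  using assms(2)
proof (induction m rule: dec_induct)
  case (step m)
  then show ?case
    using B_prefix_suffix_Suc[of m] assms(1)
    by (auto intro: prefix_order.trans suffix_order.trans)
qed simp

lemmas B_prefix = B_prefix_suffix[THEN conjunct1]
lemmas B_suffix = B_prefix_suffix[THEN conjunct2]

text \<open>A word this short inside \<open>B (Suc m)\<close> meets at most one gap of level
  \<open>m\<close>. If it does, its two pieces have length at most \<open>h n\<close>, and
  nestedness of the blocks makes them a suffix and a prefix of \<open>B n\<close>; otherwise it lies
  in \<open>B m\<close>. Thus \<open>g\<close> is the gap of whichever level separates the two
  pieces.\<close>

lemma sublist_B_short:
  assumes "1 \<le> n" "n \<le> m" "sublist w (B m)" "length w \<le> h n"
  shows "\<exists>g\<le>1. sublist w (B n @ replicate g 1 @ B n)"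
  using assms(2,3)
proof (induction m rule: dec_induct)
  case base
  then show ?case by (intro exI[of _ 0]) (auto simp: sublist_append)
next
  case (step m)
  have m: "1 \<le> m" and nm: "n \<le> m" using assms(1) step.hyps by auto
  have "length w \<le> length (B m)"
    using assms(4) prefix_length_le[OF B_prefix[OF assms(1) nm]] by (simp add: hgt_def)
  then have "sublist w (B m @ replicate (gap m) 1 @ B m)"
    using step.prems m gap_le_1 by (intro sublist_tower) (auto simp: B_Suc)
  from sublist_around_gap[OF this gap_le_1] show ?case
  proof (elim disjE exE conjE)
    fix u v assume w: "w = u @ replicate (gap m) 1 @ v" and u: "suffix u (B m)" and v: "prefix v (B m)"
    have "suffix u (B n)"
      using assms(4) by (intro suffix_length_suffix[OF u B_suffix[OF assms(1) nm]]) (simp add: w hgt_def)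
    moreover have "prefix v (B n)"
      using assms(4) by (intro prefix_length_prefix[OF v B_prefix[OF assms(1) nm]]) (simp add: w hgt_def)
    ultimately have "sublist w (B n @ replicate (gap m) 1 @ B n)"
      by (simp add: w sublist_glue)
    then show ?thesis using gap_le_1 by blast
  qed (blast intro: step.IH)+
qed

lemma lang_short:
  assumes "1 \<le> n" "w \<in> lang r (alt_spacers r) q" "q \<le> h n"
  shows "\<exists>g\<le>1. sublist w (B n @ replicate g 1 @ B n)"
proof -
  from assms(2) obtain m where m: "1 \<le> m" "sublist w (B m)" and len: "length w = q"
    by (auto simp: lang_def)
  show ?thesis
  proof (cases "n \<le> m")
    case True
    then show ?thesis using sublist_B_short assms m len by blast
  next
    case False
    then have "sublist w (B n)"
      using m B_prefix[of m n] by (auto intro: sublist_order.order_trans prefix_imp_sublist)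
    then show ?thesis by (intro exI[of _ 0]) (simp add: sublist_append)
  qed
qed

lemma sublist_P_tower:
  "sublist (concat (replicate k (P n)) @ B n) (concat (replicate (Suc k) (P n)))"
  by (simp add: replicate_append_same[symmetric] sublist_append_leftI del: replicate_append_same)

text \<open>Joining two copies of \<open>B (Suc n)\<close> by the regular gap of level
  \<open>n\<close> merely continues the pattern: the result is \<open>2 * r n + 2\<close> equally
  spaced copies of \<open>B n\<close>.\<close>

lemma B_gap_B_periodic:
  assumes "n \<ge> 1" "sublist w (B (Suc n) @ replicate (gap n) 1 @ B (Suc n))"
  shows "w \<in> periodic_words (length w) (P n)"
proof -
  have "B (Suc n) @ replicate (gap n) 1 @ B (Suc n)
      = concat (replicate (r n + Suc (r n)) (P n)) @ B n"
    unfolding replicate_add by (simp add: B_Suc[OF assms(1)])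
  then show ?thesis
    using assms(2) sublist_P_tower[of "r n + Suc (r n)" n]
    by (auto simp: periodic_words_def simp del: replicate_Suc intro: sublist_order.order_trans)
qed

text \<open>The index \<open>i\<close> is the number of letters in front of the exceptional gap.\<close>

definition junction_words :: "nat \<Rightarrow> nat \<Rightarrow> nat set \<Rightarrow> nat list set" where
  "junction_words n q I =
     (\<lambda>i. drop (h (Suc n) - i) (B (Suc n)) @ replicate (1 - gap n) 1
          @ take (q - (1 - gap n) - i) (B (Suc n))) ` I"

text \<open>The word lies in two copies of \<open>B (Suc n)\<close> with a gap of 0 or 1 between
  them. The value \<open>gap n\<close> keeps the period, so \<open>1 - gap n\<close> is the only
  exceptional value, and then \<open>length u\<close> determines the word.\<close>

lemma lang_cases:
  assumes n: "n \<ge> 1" and w: "w \<in> lang r (alt_spacers r) q" and q: "q \<le> h (Suc n)"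
  shows "w \<in> periodic_words q (P n) \<or>
    (\<exists>u v. w = u @ replicate (1 - gap n) 1 @ v \<and> suffix u (B (Suc n)) \<and> prefix v (B (Suc n))
       \<and> w \<in> junction_words n q {length u} \<and> gap n \<le> length u \<and> length u < q)"
proof -
  have len: "length w = q" using w by (simp add: lang_def)
  obtain g where g: "g \<le> 1" "sublist w (B (Suc n) @ replicate g 1 @ B (Suc n))"
    using lang_short[OF _ w q] by auto
  have per: "w \<in> periodic_words q (P n)" if "sublist w (B (Suc n))"
    using B_gap_B_periodic[OF n, of w] that len by (simp add: sublist_append)
  show ?thesis
  proof (cases "g = gap n")
    case True
    with g B_gap_B_periodic[OF n, of w] len show ?thesis by simp
  next
    case False
    with g(1) gap_le_1[of n] have g': "g = 1 - gap n" by linarith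
    from sublist_around_gap[OF g(2,1)] show ?thesis
    proof (elim disjE exE conjE)
      fix u v assume uv: "w = u @ replicate g 1 @ v" and u: "suffix u (B (Suc n))"
        and v: "prefix v (B (Suc n))" and l: "1 - g \<le> length u" "length u < length w"
      have "u = drop (h (Suc n) - length u) (B (Suc n))"
        using u by (auto simp: suffix_def hgt_def)
      moreover have "v = take (q - (1 - gap n) - length u) (B (Suc n))"
        using v uv len by (auto simp: prefix_def g')
      ultimately have "w \<in> junction_words n q {length u}"
        using uv by (simp add: junction_words_def g')
      then show ?thesis using uv u v l len g' gap_le_1[of n] by auto
    qed (use per in auto)
  qed
qed

lemma card_junction_words: 
  "finite I \<Longrightarrow> finite (junction_words n q I)" 
  "finite I \<Longrightarrow> card (junction_words n q I) \<le> card I"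
  unfolding junction_words_def by (auto intro: card_image_le)

lemma P_nonempty: "n \<ge> 1 \<Longrightarrow> P n \<noteq> []"
  using h_pos[of n] by (auto simp: hgt_def)

lemma length_P: "length (P n) = h n + gap n"
  by (simp add: hgt_def)

lemma complexity_le:
  assumes n: "n \<ge> 1" and q: "1 \<le> q" "q \<le> h (Suc n)"
  shows "complexity r (alt_spacers r) q \<le> q + h n"
proof -
  let ?S = "periodic_words q (P n) \<union> junction_words n q {gap n..<q}"
  have sub: "lang r (alt_spacers r) q \<subseteq> ?S"
    using lang_cases[OF n _ q(2)] by (fastforce simp: junction_words_def)
  have fin: "finite ?S" using card_periodic_words(1)[OF P_nonempty[OF n]] card_junction_words by simp
  have "complexity r (alt_spacers r) q \<le> card ?S"
    using complexity_le_card_lang[OF finite_subset[OF sub fin]] card_mono[OF fin sub] by linarith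
  also have "\<dots> \<le> card (periodic_words q (P n)) + card (junction_words n q {gap n..<q})"
    by (rule card_Un_le)
  \<comment> \<open>A spacer in the period adds one periodic word and removes one split point, so
    \<open>gap n\<close> cancels.\<close>
  also have "\<dots> \<le> (h n + gap n) + (q - gap n)"
    using card_periodic_words(2)[OF P_nonempty[OF n], of q]
      card_junction_words(2)[of "{gap n..<q}" n q] by (simp add: length_P[symmetric])
  finally show ?thesis using q gap_le_1[of n] by linarith
qed

lemma complexity_le_double:
  assumes n: "n \<ge> 1" and q: "h (Suc n) < q" "q \<le> 2 * h (Suc n)"
  shows "complexity r (alt_spacers r) q + h (Suc n) < 2 * q + h n"
proof -
  let ?h = "h (Suc n)" and ?m = "Suc n"
  \<comment> \<open>\<open>?I\<close> collects the splits whose left piece exceeds \<open>?h\<close>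
    letters, \<open>?J\<close> those whose right piece does. In all other splits both pieces lie
    within \<open>B ?m\<close>.\<close>
  let ?I = "{?h + 1..<q}" and ?J = "{gap ?m..<q - (1 - gap ?m) - ?h}"
  let ?S = "periodic_words q (P ?m) \<union> periodic_words q (P n) 
     \<union> junction_words ?m q ?I \<union> junction_words ?m q ?J"
  have q': "q \<le> h (Suc ?m)" using q h_double[of ?m] by simp
  have sub: "lang r (alt_spacers r) q \<subseteq> ?S"
  proof
    fix w assume w: "w \<in> lang r (alt_spacers r) q"
    then have len: "length w = q" by (simp add: lang_def)
    have "1 \<le> ?m" by simp
    from lang_cases[OF this w q'] show "w \<in> ?S"
    proof (elim disjE exE conjE)
      fix u v
      assume uv: "w = u @ replicate (1 - gap ?m) 1 @ v" and u: "suffix u (B (Suc ?m))"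
        and v: "prefix v (B (Suc ?m))" and j: "w \<in> junction_words ?m q {length u}"
        and l: "gap ?m \<le> length u" "length u < q"
      consider "length u \<in> ?I" | "length u \<in> ?J" | "length u \<le> ?h" "length v \<le> ?h"
        using l uv len by fastforce
      then show ?thesis
      proof cases
        case 3
        have "suffix u (B ?m)"
          using 3 by (intro suffix_length_suffix[OF u B_suffix]) (auto simp: hgt_def)
        moreover have "prefix v (B ?m)"
          using 3 by (intro prefix_length_prefix[OF v B_prefix]) (auto simp: hgt_def)
        \<comment> \<open>This is where alternation pays off: the exceptional gap of level
          \<open>?m\<close> is the regular gap of level \<open>n\<close>, so these words are
          periodic with period \<open>P n\<close>.\<close>
        ultimately have "sublist w (B ?m @ replicate (gap n) 1 @ B ?m)"
          using gap_le_1[of n] by (simp add: uv gap_Suc sublist_glue)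
        then show ?thesis using B_gap_B_periodic[OF n] len by auto
      qed (use j in \<open>auto simp: junction_words_def\<close>)
    qed auto
  qed
  have fin: "finite ?S"
    using card_periodic_words(1)[OF P_nonempty[OF n]] card_periodic_words(1)[OF P_nonempty[of ?m]]
      card_junction_words by simp
  have "complexity r (alt_spacers r) q \<le> card ?S"
    using complexity_le_card_lang[OF finite_subset[OF sub fin]] card_mono[OF fin sub] by linarith
  also have "\<dots> \<le> card (periodic_words q (P ?m)) + card (periodic_words q (P n))
     + card (junction_words ?m q ?I) + card (junction_words ?m q ?J)"
    by (meson add_mono card_Un_le le_refl order_trans)
  also have "\<dots> \<le> (h ?m + gap ?m) + (h n + gap n) + card ?I + card ?J"
    using card_periodic_words(2)[OF P_nonempty[OF n], of q] 
      card_periodic_words(2)[OF P_nonempty[of ?m], of q] 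
      card_junction_words(2)[of ?I ?m q] card_junction_words(2)[of ?J ?m q]
    unfolding length_P[symmetric] by (intro add_mono) auto
  \<comment> \<open>\<open>?I\<close> and \<open>?J\<close> have \<open>q - ?h - 1\<close> elements
    each and the two gaps add up to 1, so the total is \<open>2 * q - ?h + h n - 1\<close>.\<close>
  finally show ?thesis using q gap_le_1[of n] gap_Suc[of n] by simp
qed

end

section \<open>Columns as towers of disjoint intervals\<close>

lemma length_concat_map_upt: "length (concat (map f [0..<m])) = (\<Sum>i<m. length (f i))"
  by (induction m) auto

lemma nth_concat_map_upt:
  assumes "i < m" "j < length (f i)"
  shows "concat (map f [0..<m]) ! ((\<Sum>i'<i. length (f i')) + j) = f i ! j"
  using assms(1)
proof (induction m)
  case (Suc m)
  have "(\<Sum>i'<i. length (f i')) + j < (\<Sum>i'<m. length (f i'))" if "i < m"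
  proof -
    have "(\<Sum>i'<i. length (f i')) + j < (\<Sum>i'<Suc i. length (f i'))" using assms(2) by simp
    also have "\<dots> \<le> (\<Sum>i'<m. length (f i'))" using that by (intro sum_mono2) auto
    finally show ?thesis .
  qed
  then show ?case using Suc by (auto simp: nth_append length_concat_map_upt less_Suc_eq)
qed simp

text \<open>Advancing the window by one trades the term at \<open>j\<close> for the term at
  \<open>m + j\<close>, which has the same residue.\<close>

lemma sum_mod_shift:
  fixes b :: "nat \<Rightarrow> 'a :: ab_group_add"
  assumes "k dvd m"
  shows "(\<Sum>i<m. b ((i + j) mod k)) = (\<Sum>i<m. b (i mod k))"
proof (induction j)
  case (Suc j)
  let ?f = "\<lambda>i. b ((i + j) mod k)"
  have "(\<Sum>i<m. ?f (Suc i)) + ?f 0 = (\<Sum>i<m. ?f i) + ?f m"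
    using sum.lessThan_Suc[of ?f m] sum.lessThan_Suc_shift[of ?f m] by (simp add: add.commute)
  moreover have "(m + j) mod k = j mod k" using assms by (auto simp: dvd_def)
  ultimately show ?case using Suc by simp
qed simp

lemma emeasure_lborel_vimage_plus:
  fixes c :: real
  assumes "A \<in> sets borel"
  shows "emeasure lborel ((\<lambda>x. c + x) -` A) = emeasure lborel A"
  using assms lborel_distr_plus[of c] emeasure_distr[of "(+) c" lborel borel A] by simp

lemma wid_Suc: "n \<ge> 1 \<Longrightarrow> wid r (Suc n) = wid r n / (real (r n) + 1)"
  by (simp add: wid_def prod.atLeastLessThan_Suc)

lemma wid_pos: "wid r n > 0"
  by (simp add: wid_def prod_pos)

lemma Lend_Suc:
  "n \<ge> 1 \<Longrightarrow> Lend r s (Suc n) = Lend r s n + real (\<Sum>i\<le>r n. s n i) * wid r (Suc n)"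
  by (cases n) auto

lemma hgt_Suc: "n \<ge> 1 \<Longrightarrow> hgt r s (Suc n) = (r n + 1) * hgt r s n + (\<Sum>i\<le>r n. s n i)"
  by (cases n) (auto simp: hgt_def length_concat_map_upt sum.distrib lessThan_Suc_atMost[symmetric])

lemma hgt_pos: "hgt r s n > 0"
proof (cases n)
  case (Suc m)
  then show ?thesis
  proof (induction m arbitrary: n)
    case (Suc m)
    then show ?case using hgt_Suc[of "Suc m" r s] by simp
  qed (simp add: hgt_def)
qed (simp add: hgt_def)

lemma Lend_eq: "n \<ge> 1 \<Longrightarrow> Lend r s n = real (hgt r s n) * wid r n"
proof (induction n rule: dec_induct)
  case (step n)
  have "wid r n = (real (r n) + 1) * wid r (Suc n)"
    using step.hyps by (simp add: wid_Suc add_pos_nonneg order.strict_implies_not_eq[symmetric])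
  then show ?case using step by (simp add: Lend_Suc hgt_Suc algebra_simps)
qed (simp add: hgt_def wid_def)

text \<open>All endpoints in column \<open>n\<close> are multiples of the width; recording the multiples turns the
  geometry of the column into the fact that \<open>cell n\<close> enumerates an initial segment of the naturals.\<close>

fun cell :: "(nat \<Rightarrow> nat) \<Rightarrow> (nat \<Rightarrow> nat \<Rightarrow> nat) \<Rightarrow> nat \<Rightarrow> nat list" where
  "cell r s 0 = [0]"
| "cell r s (Suc 0) = [0]"
| "cell r s (Suc (Suc m)) = concat (map (\<lambda>i.
     map (\<lambda>a. a * (r (Suc m) + 1) + i) (cell r s (Suc m))
     @ map (\<lambda>k. hgt r s (Suc m) * (r (Suc m) + 1) + (\<Sum>i'<i. s (Suc m) i') + k) [0..<s (Suc m) i])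
   [0..<r (Suc m) + 1])"

lemma cell_Suc:
  "n \<ge> 1 \<Longrightarrow> cell r s (Suc n) = concat (map (\<lambda>i.
     map (\<lambda>a. a * (r n + 1) + i) (cell r s n)
     @ map (\<lambda>k. hgt r s n * (r n + 1) + (\<Sum>i'<i. s n i') + k) [0..<s n i]) [0..<r n + 1])"
  by (cases n) auto

lemma lev_Suc:
  "n \<ge> 1 \<Longrightarrow> lev r s (Suc n) = concat (map (\<lambda>i.
     map (\<lambda>a. a + real i * wid r (Suc n)) (lev r s n)
     @ map (\<lambda>k. Lend r s n + real ((\<Sum>i'<i. s n i') + k) * wid r (Suc n)) [0..<s n i]) [0..<r n + 1])"
  by (cases n) auto

lemma length_cell: "length (cell r s n) = hgt r s n"
proof (induction n rule: less_induct)
  case (less n)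
  consider "n = 0" | "n = 1" | m where "n = Suc m" "m \<ge> 1" by (cases n; cases "n - 1") auto
  then show ?case
  proof cases
    case 3
    then show ?thesis using less[of m]
      by (simp add: cell_Suc hgt_Suc length_concat_map_upt sum.distrib lessThan_Suc_atMost[symmetric]
          del: upt_Suc)
  qed (auto simp: hgt_def)
qed

text \<open>One old width is \<open>r n + 1\<close> new widths, so an old multiple \<open>a\<close>
  in subcolumn \<open>i\<close> becomes \<open>a * (r n + 1) + i\<close>, and the new spacers start
  at \<open>Lend r s n\<close>, which is \<open>hgt r s n * (r n + 1)\<close> new widths.\<close>

lemma lev_eq_cell: "n \<ge> 1 \<Longrightarrow> lev r s n = map (\<lambda>a. real a * wid r n) (cell r s n)"
proof (induction n rule: dec_induct)
  case (step n)
  have w: "wid r n = (real (r n) + 1) * wid r (Suc n)"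
    using step.hyps by (simp add: wid_Suc add_pos_nonneg order.strict_implies_not_eq[symmetric])
  show ?case
    unfolding lev_Suc[OF step.hyps(1)] cell_Suc[OF step.hyps(1)] map_concat map_map
    by (rule arg_cong[of _ _ concat], rule map_cong)
       (auto simp: step.IH Lend_eq[OF step.hyps(1)] w algebra_simps)
qed (simp add: wid_def)

lemma lessThan_add_sum:
  fixes c :: "nat \<Rightarrow> nat"
  assumes "x < (\<Sum>i<m. c i)"
  shows "\<exists>i<m. \<exists>k<c i. x = (\<Sum>i'<i. c i') + k"
  using assms
proof (induction m)
  case (Suc m)
  show ?case
  proof (cases "x < (\<Sum>i<m. c i)")
    case True
    with Suc.IH show ?thesis using less_Suc_eq by blast
  next
    case False
    with Suc.prems show ?thesis
      by (intro exI[of _ m] conjI exI[of _ "x - (\<Sum>i<m. c i)"]) auto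
  qed
qed simp

text \<open>Only one inclusion is checked by hand: a number is located by quotient and remainder
  modulo \<open>r n + 1\<close>, or as a spacer. Since the list has exactly
  \<open>hgt r s (Suc n)\<close> entries, equality follows by counting, and so does
  \<open>distinct_cell\<close>.\<close>

lemma set_cell: "n \<ge> 1 \<Longrightarrow> set (cell r s n) = {..<hgt r s n}"
proof (induction n rule: dec_induct)
  case (step n)
  let ?R = "r n + 1"
  have "{..<hgt r s (Suc n)} \<subseteq> set (cell r s (Suc n))"
  proof
    fix x assume "x \<in> {..<hgt r s (Suc n)}"
    then have x: "x < hgt r s n * ?R + (\<Sum>i<?R. s n i)"
      using step.hyps by (simp add: hgt_Suc lessThan_Suc_atMost[symmetric] mult.commute)
    show "x \<in> set (cell r s (Suc n))"
    proof (cases "x < hgt r s n * ?R")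
      case True
      then have "x div ?R \<in> set (cell r s n)" by (simp add: step.IH less_mult_imp_div_less)
      then obtain a where "a \<in> set (cell r s n)" "x = a * ?R + x mod ?R" by (metis div_mult_mod_eq)
      moreover have "x mod ?R < ?R" by simp
      ultimately show ?thesis unfolding cell_Suc[OF step.hyps(1)]
        by (fastforce simp del: upt_Suc mult_Suc_right intro!: bexI[of _ "x mod ?R"])
    next
      case False
      then have "x - hgt r s n * ?R < (\<Sum>i<?R. s n i)" using x by linarith
      from lessThan_add_sum[OF this] obtain i k where
        "i < ?R" "k < s n i" "x - hgt r s n * ?R = (\<Sum>i'<i. s n i') + k" by auto
      then have "i < ?R" "k < s n i" "x = hgt r s n * ?R + (\<Sum>i'<i. s n i') + k"
        using False by auto
      then show ?thesis unfolding cell_Suc[OF step.hyps(1)]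
        by (force simp del: upt_Suc)
    qed
  qed
  moreover from card_mono[OF finite_set this]
  have "card {..<hgt r s (Suc n)} = card (set (cell r s (Suc n)))"
    using card_length[of "cell r s (Suc n)"] by (simp add: length_cell)
  ultimately have "{..<hgt r s (Suc n)} = set (cell r s (Suc n))"
    by (intro card_subset_eq) auto
  then show ?case by simp
qed (auto simp: hgt_def)

lemma distinct_cell: "n \<ge> 1 \<Longrightarrow> distinct (cell r s n)"
  by (rule card_distinct) (simp add: set_cell length_cell)

lemma length_lev: "n \<ge> 1 \<Longrightarrow> length (lev r s n) = hgt r s n"
  by (simp add: lev_eq_cell length_cell)

definition level :: "(nat \<Rightarrow> nat) \<Rightarrow> (nat \<Rightarrow> nat \<Rightarrow> nat) \<Rightarrow> nat \<Rightarrow> nat \<Rightarrow> real set" where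
  "level r s n j = {lev r s n ! j ..< lev r s n ! j + wid r n}"

lemma in_nontop_level_iff:
  "in_nontop_level r s n j x \<longleftrightarrow> n \<ge> 1 \<and> Suc j < hgt r s n \<and> x \<in> level r s n j"
  by (auto simp: in_nontop_level_def level_def length_lev)

lemma level_borel [measurable]: "level r s n j \<in> sets borel"
  by (simp add: level_def)

lemma level_eq_cell:
  assumes "n \<ge> 1" "j < hgt r s n"
  shows "level r s n j = {real (cell r s n ! j) * wid r n ..< (real (cell r s n ! j) + 1) * wid r n}"
  using assms by (simp add: level_def lev_eq_cell length_cell algebra_simps)

lemma cell_interval_iff:
  assumes "w > 0"
  shows "x \<in> {real a * w ..< (real a + 1) * w} \<longleftrightarrow> \<lfloor>x / w\<rfloor> = int a"
  using assms by (auto simp: floor_eq_iff field_simps)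

lemma level_disjoint:
  assumes "n \<ge> 1" "i < hgt r s n" "j < hgt r s n" "x \<in> level r s n i" "x \<in> level r s n j"
  shows "i = j"
proof -
  have "cell r s n ! i = cell r s n ! j"
    using assms wid_pos by (simp add: level_eq_cell cell_interval_iff del: atLeastLessThan_iff)
  then show ?thesis using distinct_cell[OF assms(1)] assms(2,3)
    by (simp add: nth_eq_iff_index_eq length_cell)
qed

lemma Union_level:
  assumes "n \<ge> 1"
  shows "(\<Union>j<hgt r s n. level r s n j) = {0..<Lend r s n}"
proof (intro equalityI subsetI)
  fix x assume "x \<in> (\<Union>j<hgt r s n. level r s n j)"
  then obtain j where j: "j < hgt r s n" "x \<in> level r s n j" by auto
  then have "cell r s n ! j \<in> set (cell r s n)" by (simp add: length_cell)
  then have c: "real (cell r s n ! j) + 1 \<le> real (hgt r s n)" using assms by (simp add: set_cell)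
  from j assms have x: "real (cell r s n ! j) * wid r n \<le> x" "x < (real (cell r s n ! j) + 1) * wid r n"
    by (auto simp: level_eq_cell)
  have "0 \<le> real (cell r s n ! j) * wid r n" using wid_pos[of r n] by simp
  moreover have "(real (cell r s n ! j) + 1) * wid r n \<le> Lend r s n"
    using mult_right_mono[OF c, of "wid r n"] wid_pos[of r n] assms by (simp add: Lend_eq)
  ultimately show "x \<in> {0..<Lend r s n}" using x by simp
next
  fix x assume x: "x \<in> {0..<Lend r s n}"
  have w: "wid r n > 0" by (rule wid_pos)
  define a where "a = nat \<lfloor>x / wid r n\<rfloor>"
  have a: "\<lfloor>x / wid r n\<rfloor> = int a" using x w by (simp add: a_def)
  have "x / wid r n < real (hgt r s n)" using x w assms by (simp add: Lend_eq field_simps)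
  then have "int a < int (hgt r s n)" unfolding a[symmetric] by (simp add: floor_less_iff)
  then have "a \<in> set (cell r s n)" using assms by (simp add: set_cell)
  then obtain j where "j < hgt r s n" "cell r s n ! j = a" by (auto simp: in_set_conv_nth length_cell)
  then show "x \<in> (\<Union>j<hgt r s n. level r s n j)"
    using a assms w by (auto simp: level_eq_cell cell_interval_iff simp del: atLeastLessThan_iff)
qed

section \<open>Copies of a column inside the next one, and the map T\<close>

definition copy_offset :: "(nat \<Rightarrow> nat) \<Rightarrow> (nat \<Rightarrow> nat \<Rightarrow> nat) \<Rightarrow> nat \<Rightarrow> nat \<Rightarrow> nat" where
  "copy_offset r s n i = (\<Sum>i'<i. hgt r s n + s n i')"

lemma copy_offset_less:
  assumes "n \<ge> 1" "i \<le> r n" "j < hgt r s n"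
  shows "copy_offset r s n i + j < hgt r s (Suc n)"
proof -
  have "copy_offset r s n i + j < copy_offset r s n (Suc i)"
    using assms(3) by (simp add: copy_offset_def)
  also have "\<dots> \<le> copy_offset r s n (Suc (r n))"
    unfolding copy_offset_def using assms(2) by (intro sum_mono2) auto
  also have "\<dots> = hgt r s (Suc n)"
    using assms(1) by (simp add: copy_offset_def hgt_Suc sum.distrib lessThan_Suc_atMost del: sum.lessThan_Suc)
  finally show ?thesis .
qed

lemma lev_copy:
  assumes "n \<ge> 1" "i \<le> r n" "j < hgt r s n"
  shows "lev r s (Suc n) ! (copy_offset r s n i + j) = lev r s n ! j + real i * wid r (Suc n)"
proof -
  let ?f = "\<lambda>i. map (\<lambda>a. a + real i * wid r (Suc n)) (lev r s n)
     @ map (\<lambda>k. Lend r s n + real ((\<Sum>i'<i. s n i') + k) * wid r (Suc n)) [0..<s n i]"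
  have len: "length (?f i) = hgt r s n + s n i" for i using assms(1) by (simp add: length_lev)
  have "concat (map ?f [0..<r n + 1]) ! ((\<Sum>i'<i. length (?f i')) + j) = ?f i ! j"
    using assms by (intro nth_concat_map_upt) (auto simp: length_lev)
  then show ?thesis unfolding len
    using assms by (simp add: lev_Suc copy_offset_def nth_append length_lev)
qed

lemma level_split:
  assumes "n \<ge> 1" "j < hgt r s n"
  shows "level r s n j = (\<Union>i\<le>r n. level r s (Suc n) (copy_offset r s n i + j))"
proof -
  let ?w = "wid r (Suc n)" and ?l = "lev r s n ! j"
  have w: "?w > 0" "wid r n = (real (r n) + 1) * ?w"
    using assms(1) wid_pos[of r "Suc n"]
    by (auto simp: wid_Suc add_pos_nonneg order.strict_implies_not_eq[symmetric])
  have lev: "level r s (Suc n) (copy_offset r s n i + j) = {?l + real i * ?w ..< ?l + (real i + 1) * ?w}"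
    if "i \<le> r n" for i
    using that assms by (simp add: level_def lev_copy distrib_right add.assoc)
  show ?thesis
  proof (intro equalityI subsetI)
    fix x assume x: "x \<in> level r s n j"
    define i where "i = nat \<lfloor>(x - ?l) / ?w\<rfloor>"
    have i: "\<lfloor>(x - ?l) / ?w\<rfloor> = int i" using x w(1) by (simp add: i_def level_def)
    have "(x - ?l) / ?w < real (r n + 1)" using x w by (auto simp: level_def field_simps)
    then have "int i < int (r n + 1)" unfolding i[symmetric] by (simp add: floor_less_iff)
    then have ir: "i \<le> r n" by simp
    have "x - ?l \<in> {real i * ?w ..< (real i + 1) * ?w}" using i w(1) cell_interval_iff by blast
    then show "x \<in> (\<Union>i\<le>r n. level r s (Suc n) (copy_offset r s n i + j))"
      using ir by (auto simp: lev intro!: bexI[of _ i])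
  next
    fix x assume "x \<in> (\<Union>i\<le>r n. level r s (Suc n) (copy_offset r s n i + j))"
    then obtain i where i: "i \<le> r n" "?l + real i * ?w \<le> x" "x < ?l + (real i + 1) * ?w"
      by (auto simp: lev)
    have "(real i + 1) * ?w \<le> wid r n" unfolding w(2) using i(1) w(1) by (intro mult_right_mono) auto
    moreover have "0 \<le> real i * ?w" using w(1) by simp
    ultimately show "x \<in> level r s n j" using i by (simp add: level_def)
  qed
qed

text \<open>Inside the copy of column \<open>n\<close> in subcolumn \<open>i\<close>, the pieces of
  two consecutive levels are moved by the same amount \<open>i * wid r (Suc n)\<close>, so the
  translation vector survives refinement.\<close>

lemma Tmap_welldef_step:
  assumes "in_nontop_level r s n j x"
  shows "\<exists>j'. in_nontop_level r s (Suc n) j' x \<and>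
    lev r s (Suc n) ! Suc j' - lev r s (Suc n) ! j' = lev r s n ! Suc j - lev r s n ! j"
proof -
  from assms have n: "n \<ge> 1" and j: "Suc j < hgt r s n" and x: "x \<in> level r s n j"
    by (auto simp: in_nontop_level_iff)
  from x n j obtain i where i: "i \<le> r n" "x \<in> level r s (Suc n) (copy_offset r s n i + j)"
    by (auto simp: level_split)
  have "lev r s (Suc n) ! (copy_offset r s n i + Suc j) - lev r s (Suc n) ! (copy_offset r s n i + j)
    = lev r s n ! Suc j - lev r s n ! j"
    using n i j by (simp add: lev_copy del: add_Suc_right)
  moreover have "copy_offset r s n i + Suc j < hgt r s (Suc n)"
    by (rule copy_offset_less[OF n i(1) j])
  ultimately show ?thesis using i n
    by (intro exI[of _ "copy_offset r s n i + j"]) (simp add: in_nontop_level_iff)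
qed

lemma Tmap_welldef_le:
  assumes "in_nontop_level r s n j x" "n \<le> m"
  shows "\<exists>j'. in_nontop_level r s m j' x \<and>
    lev r s m ! Suc j' - lev r s m ! j' = lev r s n ! Suc j - lev r s n ! j"
  using assms(2)
proof (induction m rule: dec_induct)
  case (step m)
  then show ?case using Tmap_welldef_step by metis
qed (use assms in blast)

text \<open>Both levels are refined to column \<open>max n m\<close>, where disjointness leaves only
  one level containing \<open>x\<close>. Hence the choice made in \<open>Tmap\<close> is
  immaterial.\<close>

lemma Tmap_welldef:
  assumes "in_nontop_level r s n j x" "in_nontop_level r s m i x"
  shows "lev r s n ! Suc j - lev r s n ! j = lev r s m ! Suc i - lev r s m ! i"
proof -
  obtain j' where j': "in_nontop_level r s (max n m) j' x"
    "lev r s (max n m) ! Suc j' - lev r s (max n m) ! j' = lev r s n ! Suc j - lev r s n ! j"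
    using Tmap_welldef_le[OF assms(1), of "max n m"] by auto
  obtain i' where i': "in_nontop_level r s (max n m) i' x"
    "lev r s (max n m) ! Suc i' - lev r s (max n m) ! i' = lev r s m ! Suc i - lev r s m ! i"
    using Tmap_welldef_le[OF assms(2), of "max n m"] by auto
  have "j' = i'" using j'(1) i'(1) 
    by (intro level_disjoint[of "max n m" j' r s i' x]) (auto simp: in_nontop_level_iff)
  then show ?thesis using j' i' by simp
qed

lemma Tmap_eq:
  assumes "in_nontop_level r s n j x"
  shows "Tmap r s x = x - lev r s n ! j + lev r s n ! Suc j"
proof -
  let ?Q = "\<lambda>y. \<exists>n j. in_nontop_level r s n j x \<and> y = x - lev r s n ! j + lev r s n ! Suc j"
  have "?Q (SOME y. ?Q y)" by (rule someI_ex) (use assms in blast)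
  then obtain m i where "in_nontop_level r s m i x"
    "(SOME y. ?Q y) = x - lev r s m ! i + lev r s m ! Suc i" by blast
  then show ?thesis using assms Tmap_welldef[OF assms] by (auto simp: Tmap_def)
qed

lemma Tmap_funpow:
  assumes "n \<ge> 1" "j + k < hgt r s n" "x \<in> level r s n j"
  shows "(Tmap r s ^^ k) x = x - lev r s n ! j + lev r s n ! (j + k)"
  using assms(2)
proof (induction k)
  case (Suc k)
  have "in_nontop_level r s n (j + k) ((Tmap r s ^^ k) x)"
    using Suc assms by (auto simp: in_nontop_level_iff level_def)
  from Tmap_eq[OF this] show ?case using Suc by simp
qed simp

text \<open>The map is a translation on each of countably many levels and the identity off their
  union.\<close>

lemma Tmap_borel [measurable]: "Tmap r s \<in> borel_measurable borel"
proof (rule measurableI)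
  fix A :: "real set" assume A: "A \<in> sets borel"
  let ?c = "\<lambda>n j. lev r s n ! Suc j - lev r s n ! j"
  have out: "Tmap r s x = x" if "x \<notin> (\<Union>n\<in>{1..}. \<Union>j\<in>{j. Suc j < hgt r s n}. level r s n j)" for x
  proof -
    have "\<not> in_nontop_level r s n j x" for n j using that by (auto simp: in_nontop_level_iff)
    then show ?thesis by (simp add: Tmap_def)
  qed
  have "in": "Tmap r s x \<in> A \<longleftrightarrow> ?c n j + x \<in> A"
    if "n \<ge> 1" "Suc j < hgt r s n" "x \<in> level r s n j" for n j x
  proof -
    have "Tmap r s x = ?c n j + x"
      using Tmap_eq[of r s n j x] that by (simp add: in_nontop_level_iff)
    then show ?thesis by simp
  qed
  have "Tmap r s -` A = (\<Union>n\<in>{1..}. \<Union>j\<in>{j. Suc j < hgt r s n}. level r s n j \<inter> (\<lambda>x. ?c n j + x) -` A)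
      \<union> (A - (\<Union>n\<in>{1..}. \<Union>j\<in>{j. Suc j < hgt r s n}. level r s n j))" (is "_ = ?R")
  proof (rule set_eqI)
    fix x
    show "x \<in> Tmap r s -` A \<longleftrightarrow> x \<in> ?R"
    proof (cases "x \<in> (\<Union>n\<in>{1..}. \<Union>j\<in>{j. Suc j < hgt r s n}. level r s n j)")
      case True
      then show ?thesis using "in" by blast
    next
      case False
      then show ?thesis using out[OF False] by auto
    qed
  qed
  also have "\<dots> \<in> sets borel"
  proof (intro sets.Un sets.Diff sets.countable_UN'' A)
    fix n j
    have "(\<lambda>x. ?c n j + x) -` A \<in> sets borel"
      using measurable_sets[of "\<lambda>x. ?c n j + x" borel borel A] A by simp
    then show "level r s n j \<inter> (\<lambda>x. ?c n j + x) -` A \<in> sets borel"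
      by auto
  qed auto
  finally show "Tmap r s -` A \<inter> space borel \<in> sets borel" by simp
qed simp

lemma emeasure_level_Tmap_funpow:
  assumes "n \<ge> 1" "j + k < hgt r s n" "A \<in> sets borel"
  shows "emeasure lborel (level r s n j \<inter> (Tmap r s ^^ k) -` A) = emeasure lborel (level r s n (j + k) \<inter> A)"
proof -
  let ?c = "lev r s n ! (j + k) - lev r s n ! j"
  have "level r s n j \<inter> (Tmap r s ^^ k) -` A = (\<lambda>x. ?c + x) -` (level r s n (j + k) \<inter> A)"
  proof (rule set_eqI)
    fix x
    have "x \<in> level r s n j \<longleftrightarrow> ?c + x \<in> level r s n (j + k)"
      by (auto simp: level_def)
    moreover have "(Tmap r s ^^ k) x = ?c + x" if "x \<in> level r s n j"
      using Tmap_funpow[OF assms(1,2) that] by simp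
    ultimately show "x \<in> level r s n j \<inter> (Tmap r s ^^ k) -` A
        \<longleftrightarrow> x \<in> (\<lambda>x. ?c + x) -` (level r s n (j + k) \<inter> A)" by auto
  qed
  then show ?thesis using assms(3) emeasure_lborel_vimage_plus[of "level r s n (j + k) \<inter> A" ?c] by simp
qed

lemma measure_preserving_funpow:
  assumes "measure_preserving_map M f"
  shows "measure_preserving_map M (f ^^ k)"
proof (induction k)
  case 0
  have "id -` A \<inter> space M = A" if "A \<in> sets M" for A
    using sets.sets_into_space[OF that] by auto
  then show ?case by (simp add: measure_preserving_map_def id_def)
next
  case (Suc k)
  have f: "f \<in> measurable M M" using assms by (simp add: measure_preserving_map_def)
  have fk: "f ^^ k \<in> measurable M M" using Suc by (simp add: measure_preserving_map_def)
  show ?case unfolding measure_preserving_map_def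
  proof (intro conjI ballI)
    show "f ^^ Suc k \<in> measurable M M" using measurable_comp[OF fk f] by (simp add: comp_def)
    fix A assume A: "A \<in> sets M"
    have "(f ^^ Suc k) -` A \<inter> space M = (f ^^ k) -` (f -` A \<inter> space M) \<inter> space M"
      using measurable_space[OF fk] by auto
    also have "emeasure M \<dots> = emeasure M (f -` A \<inter> space M)"
      using Suc measurable_sets[OF f A] unfolding measure_preserving_map_def by blast
    also have "\<dots> = emeasure M A" using assms A by (simp add: measure_preserving_map_def)
    finally show "emeasure M ((f ^^ Suc k) -` A \<inter> space M) = emeasure M A" .
  qed
qed

section \<open>Invariance of the measure\<close>

locale columns =
  fixes r :: "nat \<Rightarrow> nat" and s :: "nat \<Rightarrow> nat \<Rightarrow> nat"
  assumes r_ge_1: "n \<ge> 1 \<Longrightarrow> r n \<ge> 1"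
    and Lend_bdd: "bdd_above (range (Lend r s))"
begin

abbreviation T where "T \<equiv> Tmap r s"
abbreviation w where "w \<equiv> wid r"
abbreviation X where "X \<equiv> rspace r s"
abbreviation h where "h \<equiv> hgt r s"

definition L :: real where "L = (SUP n. Lend r s n)"

lemma Lend_le_L: "Lend r s n \<le> L"
  unfolding L_def by (rule cSUP_upper[OF UNIV_I Lend_bdd])

lemma X_eq: "X = {0..<L}"
proof -
  have "x < L \<longleftrightarrow> (\<exists>n. x < Lend r s n)" for x
    unfolding L_def using less_cSUP_iff[OF _ Lend_bdd] by auto
  then show ?thesis by (auto simp: rspace_def)
qed

lemma L_ge_1: "L \<ge> 1"
  using Lend_le_L[of 0] by simp

lemma Lend_incseq: "incseq (Lend r s)"
proof (rule incseq_SucI)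
  fix n
  show "Lend r s n \<le> Lend r s (Suc n)"
    using wid_pos[of r "Suc n"] by (cases n) (auto intro!: mult_nonneg_nonneg sum_nonneg)
qed

lemma Lend_tendsto: "Lend r s \<longlonglongrightarrow> L"
  unfolding L_def by (rule LIMSEQ_incseq_SUP[OF Lend_bdd Lend_incseq])

lemma wid_tendsto: "w \<longlonglongrightarrow> 0"
proof -
  have "w n \<le> (1/2) ^ (n - 1)" if "n \<ge> 1" for n
    using that
  proof (induction n rule: dec_induct)
    case (step n)
    have "w (Suc n) \<le> w n / 2"
      using step.hyps r_ge_1[of n] wid_pos[of r n] unfolding wid_Suc[OF step.hyps(1)]
      by (intro divide_left_mono) auto
    also have "\<dots> \<le> (1/2) ^ (n - 1) / 2" using step by simp
    also have "\<dots> = (1/2) ^ (Suc n - 1)" using step.hyps by (cases n) auto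
    finally show ?case .
  qed (simp add: wid_def)
  from this[of "Suc n" for n] have "w (Suc n) \<le> (1/2) ^ n" for n by simp
  then have "(\<lambda>n. w (Suc n)) \<longlonglongrightarrow> 0"
    by (intro tendsto_sandwich[OF _ _ tendsto_const LIMSEQ_power_zero[of "1/2::real"]])
       (auto intro!: always_eventually less_imp_le[OF wid_pos])
  then show ?thesis by (rule LIMSEQ_imp_Suc)
qed

text \<open>The part of the space not yet covered by column \<open>n\<close>, plus one level: the
  error when one works inside column \<open>n\<close> and discards its top or bottom level.\<close>

definition rest :: "nat \<Rightarrow> real" where "rest n = L - Lend r s n + w n"

lemma rest_tendsto: "rest \<longlonglongrightarrow> 0"
  unfolding rest_def using tendsto_add[OF tendsto_diff[OF tendsto_const Lend_tendsto, of L] wid_tendsto] by simp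

lemma level_subset: "n \<ge> 1 \<Longrightarrow> j < h n \<Longrightarrow> level r s n j \<subseteq> {0..<Lend r s n}"
  using Union_level[of n r s] by blast

lemma emeasure_Union_levels:
  assumes "n \<ge> 1" "J \<subseteq> {..<h n}" "A \<in> sets borel"
  shows "emeasure lborel ((\<Union>j\<in>J. level r s n j) \<inter> A) = (\<Sum>j\<in>J. emeasure lborel (level r s n j \<inter> A))"
proof -
  have "disjoint_family_on (\<lambda>j. level r s n j \<inter> A) J"
    unfolding disjoint_family_on_def using level_disjoint[OF assms(1)] assms(2) by blast
  moreover have "finite J" using assms(2) finite_subset by blast
  ultimately have "(\<Sum>j\<in>J. emeasure lborel (level r s n j \<inter> A)) 
      = emeasure lborel (\<Union>j\<in>J. level r s n j \<inter> A)"
    using assms(3) by (intro sum_emeasure) auto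
  then show ?thesis by (simp add: Int_UN_distrib2 Int_commute)
qed

lemma emeasure_level: "emeasure lborel (level r s n j) = ennreal (w n)"
  using wid_pos[of r n] by (simp add: level_def)

lemma emeasure_rest:
  assumes "n \<ge> 1" "i < h n"
  shows "emeasure lborel (X - (\<Union>j\<in>{..<h n} - {i}. level r s n j)) \<le> ennreal (rest n)"
proof -
  have "X - (\<Union>j\<in>{..<h n} - {i}. level r s n j) \<subseteq> {Lend r s n..<L} \<union> level r s n i"
  proof
    fix x assume x: "x \<in> X - (\<Union>j\<in>{..<h n} - {i}. level r s n j)"
    show "x \<in> {Lend r s n..<L} \<union> level r s n i"
    proof (cases "x < Lend r s n")
      case True
      then have "x \<in> (\<Union>j<h n. level r s n j)"
        using x by (simp only: Union_level[OF assms(1)]) (simp add: X_eq)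
      then show ?thesis using x by blast
    qed (use x in \<open>simp add: X_eq\<close>)
  qed
  then have "emeasure lborel (X - (\<Union>j\<in>{..<h n} - {i}. level r s n j))
      \<le> emeasure lborel ({Lend r s n..<L} \<union> level r s n i)"
    by (intro emeasure_mono) auto
  also have "\<dots> \<le> emeasure lborel {Lend r s n..<L} + emeasure lborel (level r s n i)"
    by (rule emeasure_subadditive) auto
  also have "\<dots> = ennreal (rest n)"
    using Lend_le_L[of n] wid_pos[of r n] by (simp add: emeasure_level rest_def ennreal_plus[symmetric] del: ennreal_plus)
  finally show ?thesis .
qed

lemma X_borel [measurable]: "X \<in> sets borel" by (simp add: X_eq)

text \<open>\<open>T\<close> carries the levels other than the top one (\<open>?Y\<close>) by
  translation onto the levels other than the bottom one (\<open>?Z\<close>). Each of these unions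
  fills \<open>X\<close> up to measure \<open>rest n\<close>, which tends to 0.\<close>

lemma Tmap_preserves_lborel:
  assumes A [measurable]: "A \<in> sets borel"
  shows "emeasure lborel (X \<inter> T -` A) = emeasure lborel (X \<inter> A)"
proof -
  have TA [measurable]: "T -` A \<in> sets borel" using measurable_sets[OF Tmap_borel A] by simp
  let ?Y = "\<lambda>n. \<Union>j\<in>{..<h n} - {h n - 1}. level r s n j"
  let ?Z = "\<lambda>n. \<Union>j\<in>{..<h n} - {0}. level r s n j"
  have bound: "emeasure lborel (X \<inter> E) \<le> emeasure lborel (U \<inter> E) + ennreal (rest n)"
    if "E \<in> sets borel" "U \<in> sets borel" "emeasure lborel (X - U) \<le> ennreal (rest n)" for E U n
  proof -
    have "emeasure lborel (X \<inter> E) \<le> emeasure lborel (U \<inter> E \<union> (X - U))"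
      using that by (intro emeasure_mono) auto
    also have "\<dots> \<le> emeasure lborel (U \<inter> E) + emeasure lborel (X - U)"
      using that by (intro emeasure_subadditive) auto
    finally show ?thesis using that(3) add_left_mono order_trans by blast
  qed
  have sub: "(\<Union>j\<in>{..<h n} - {i}. level r s n j) \<subseteq> X" if "n \<ge> 1" for n i
  proof -
    have "(\<Union>j\<in>{..<h n} - {i}. level r s n j) \<subseteq> {0..<Lend r s n}"
      using level_subset[OF that] by blast
    also have "\<dots> \<subseteq> X" using Lend_le_L[of n] by (auto simp: X_eq)
    finally show ?thesis .
  qed
  have YZ: "emeasure lborel (?Y n \<inter> T -` A) = emeasure lborel (?Z n \<inter> A)" if n: "n \<ge> 1" for n
  proof -
    have "emeasure lborel (?Y n \<inter> T -` A) = (\<Sum>j\<in>{..<h n} - {h n - 1}. emeasure lborel (level r s n j \<inter> T -` A))"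
      by (rule emeasure_Union_levels[OF n _ TA]) auto
    also have "\<dots> = (\<Sum>j\<in>{..<h n} - {h n - 1}. emeasure lborel (level r s n (Suc j) \<inter> A))"
      using emeasure_level_Tmap_funpow[OF n _ A, of _ 1 r s] by (intro sum.cong) auto
    also have "\<dots> = (\<Sum>j\<in>{..<h n} - {0}. emeasure lborel (level r s n j \<inter> A))"
      by (rule sum.reindex_bij_witness[of _ "\<lambda>j. j - 1" Suc]) auto
    also have "\<dots> = emeasure lborel (?Z n \<inter> A)"
      by (rule emeasure_Union_levels[OF n _ A, symmetric]) auto
    finally show ?thesis .
  qed
  have le1: "emeasure lborel (X \<inter> T -` A) \<le> emeasure lborel (X \<inter> A) + ennreal (rest n)" if n: "n \<ge> 1" for n
  proof -
    have "emeasure lborel (X \<inter> T -` A) \<le> emeasure lborel (?Y n \<inter> T -` A) + ennreal (rest n)"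
      using hgt_pos[of r s n] by (intro bound emeasure_rest n) auto
    also have "emeasure lborel (?Y n \<inter> T -` A) \<le> emeasure lborel (X \<inter> A)"
      unfolding YZ[OF n] using sub[OF n] by (intro emeasure_mono) auto
    finally show ?thesis by (simp add: add_right_mono)
  qed
  have le2: "emeasure lborel (X \<inter> A) \<le> emeasure lborel (X \<inter> T -` A) + ennreal (rest n)" if n: "n \<ge> 1" for n
  proof -
    have "emeasure lborel (X \<inter> A) \<le> emeasure lborel (?Z n \<inter> A) + ennreal (rest n)"
      using hgt_pos[of r s n] by (intro bound emeasure_rest n) auto
    also have "emeasure lborel (?Z n \<inter> A) \<le> emeasure lborel (X \<inter> T -` A)"
      unfolding YZ[OF n, symmetric] using sub[OF n] by (intro emeasure_mono) auto
    finally show ?thesis by (simp add: add_right_mono)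
  qed
  have lim: "a \<le> b" if "\<And>n. n \<ge> 1 \<Longrightarrow> a \<le> b + ennreal (rest n)" for a b
  proof -
    have "(\<lambda>n. b + ennreal (rest n)) \<longlonglongrightarrow> b + ennreal 0"
      by (intro tendsto_add tendsto_const tendsto_ennrealI rest_tendsto)
    then show ?thesis using that by (intro Lim_bounded2[where N = 1]) auto
  qed
  show ?thesis using lim[OF le1] lim[OF le2] by (rule antisym)
qed

lemma emeasure_rmeas:
  assumes "A \<in> sets borel"
  shows "emeasure (rmeas r s) A = emeasure lborel (X \<inter> A) / ennreal L"
  using assms L_ge_1 by (simp add: rmeas_def X_eq)

lemma space_rmeas: "space (rmeas r s) = UNIV" and sets_rmeas: "sets (rmeas r s) = sets borel"
  by (auto simp: rmeas_def)

lemma Tmap_measure_preserving: "measure_preserving_map (rmeas r s) T"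
  unfolding measure_preserving_map_def
proof (intro conjI ballI)
  show "T \<in> measurable (rmeas r s) (rmeas r s)"
    using Tmap_borel[of r s] measurable_cong_sets[OF sets_rmeas sets_rmeas] by simp
  fix A assume "A \<in> sets (rmeas r s)"
  then have A: "A \<in> sets borel" by (simp add: sets_rmeas)
  have "T -` A \<in> sets borel" using measurable_sets[OF Tmap_borel A] by simp
  then show "emeasure (rmeas r s) (T -` A \<inter> space (rmeas r s)) = emeasure (rmeas r s) A"
    using A by (simp add: space_rmeas emeasure_rmeas Tmap_preserves_lborel)
qed

section \<open>Equal density on the levels forces a set to be trivial\<close>

lemma emeasure_Int_interval: "emeasure lborel (A \<inter> {a..<b}) \<noteq> \<infinity>" for a b :: real
proof -
  have "emeasure lborel (A \<inter> {a..<b}) \<le> emeasure lborel {a..<b}" by (intro emeasure_mono) auto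
  also have "\<dots> < \<infinity>" by (cases "a \<le> b") auto
  finally show ?thesis by simp
qed

lemma measure_interval_split:
  fixes a b c :: real
  assumes "A \<in> sets borel" "a \<le> b" "b \<le> c"
  shows "measure lborel (A \<inter> {a..<c}) = measure lborel (A \<inter> {a..<b}) + measure lborel (A \<inter> {b..<c})"
proof -
  have "A \<inter> {a..<c} = (A \<inter> {a..<b}) \<union> (A \<inter> {b..<c})" using assms by auto
  then show ?thesis
    using assms emeasure_Int_interval by (simp add: measure_Union disjoint_iff)
qed

text \<open>Although the levels are stacked in another order, each interval between consecutive
  multiples of the width is one of them, so the measure can be added up from left to right.\<close>

lemma measure_cells:
  assumes n: "n \<ge> 1" and A: "A \<in> sets borel"
    and eq: "\<And>j. j < h n \<Longrightarrow> measure lborel (A \<inter> level r s n j) = d * w n"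
    and "k \<le> h n"
  shows "measure lborel (A \<inter> {0..<real k * w n}) = d * (real k * w n)"
  using assms(4)
proof (induction k)
  case (Suc k)
  have "k \<in> set (cell r s n)" using Suc.prems n by (simp add: set_cell)
  then obtain j where "j < h n" "cell r s n ! j = k" by (auto simp: in_set_conv_nth length_cell)
  then have j: "measure lborel (A \<inter> {real k * w n..<(real k + 1) * w n}) = d * w n"
    using eq[of j] n by (simp add: level_eq_cell)
  have w: "w n > 0" by (rule wid_pos)
  have "measure lborel (A \<inter> {0..<(real k + 1) * w n})
      = measure lborel (A \<inter> {0..<real k * w n}) + measure lborel (A \<inter> {real k * w n..<(real k + 1) * w n})"
    using w by (intro measure_interval_split A) auto
  then show ?case using Suc j by (simp add: algebra_simps)
qed simp

lemma measure_interval_le: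
  fixes a b :: real
  assumes "A \<in> sets borel" "a \<le> b"
  shows "measure lborel (A \<inter> {a..<b}) \<le> b - a"
  using measure_mono_fmeasurable[of "A \<inter> {a..<b}" "{a..<b}" lborel] assms
  by (auto simp: fmeasurable_def)

lemma measure_approx:
  assumes n: "n \<ge> 1" and A: "A \<in> sets borel"
    and eq: "\<And>j. j < h n \<Longrightarrow> measure lborel (A \<inter> level r s n j) = d * w n"
    and t: "0 \<le> t" "t \<le> L"
  shows "\<bar>measure lborel (A \<inter> {0..<t}) - d * t\<bar> \<le> rest n"
proof -
  have w: "w n > 0" by (rule wid_pos)
  \<comment> \<open>\<open>u\<close> is the last grid point of column \<open>n\<close> up to
    \<open>t\<close>. The piece from \<open>u\<close> to \<open>t\<close> is shorter than one width
    or else lies beyond the column; in both cases its length is at most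
    \<open>rest n\<close>.\<close>
  define k where "k = min (nat \<lfloor>t / w n\<rfloor>) (h n)"
  define u where "u = real k * w n"
  have k_le: "real k \<le> t / w n"
  proof -
    have "real (nat \<lfloor>t / w n\<rfloor>) \<le> t / w n" using t w by simp
    then show ?thesis by (simp add: k_def min_le_iff_disj)
  qed
  have u: "0 \<le> u" "u \<le> t" using k_le w by (auto simp: u_def field_simps)
  have tu: "t - u \<le> rest n"
  proof (cases "k = h n")
    case True
    then show ?thesis using t w n by (simp add: u_def rest_def Lend_eq)
  next
    case False
    then have "k = nat \<lfloor>t / w n\<rfloor>" by (auto simp: k_def min_def split: if_splits)
    then have "t / w n < real k + 1" using t w by simp
    then have "t - u < w n" using w by (simp add: u_def field_simps)
    then show ?thesis using Lend_le_L[of n] by (simp add: rest_def)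
  qed
  have Fu: "measure lborel (A \<inter> {0..<u}) = d * u"
    unfolding u_def by (rule measure_cells[OF n A eq]) (auto simp: k_def)
  have d: "0 \<le> d" "d \<le> 1"
  proof -
    have e: "measure lborel (A \<inter> level r s n 0) = d * w n" using eq hgt_pos by blast
    have "0 \<le> d * w n" unfolding e[symmetric] by simp
    moreover have "d * w n \<le> w n" unfolding e[symmetric] level_def
      using measure_interval_le[OF A, of "lev r s n ! 0" "lev r s n ! 0 + w n"] w by simp
    ultimately show "0 \<le> d" "d \<le> 1" using w by (auto simp: zero_le_mult_iff)
  qed
  have "measure lborel (A \<inter> {0..<t}) = d * u + measure lborel (A \<inter> {u..<t})"
    using measure_interval_split[OF A u] Fu by simp
  moreover have "measure lborel (A \<inter> {u..<t}) \<le> t - u" by (rule measure_interval_le[OF A u(2)])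
  moreover have "0 \<le> d * (t - u)" "d * (t - u) \<le> t - u"
    using d u mult_right_mono[of d 1 "t - u"] by auto
  ultimately show ?thesis
    using tu measure_nonneg[of lborel "A \<inter> {u..<t}"] unfolding right_diff_distrib by linarith
qed

text \<open>The density \<open>d\<close> may vary with \<open>n\<close>, but
  \<open>measure_approx\<close> at 1 pins it down up to \<open>rest n\<close>. The deviation from
  linearity is then at most \<open>rest n * (1 + t)\<close> for infinitely many
  \<open>n\<close>.\<close>

lemma measure_linear:
  assumes A: "A \<in> sets borel"
    and eq: "\<exists>\<^sub>\<infinity>n. n \<ge> 1 \<and> (\<exists>d. \<forall>j<h n. measure lborel (A \<inter> level r s n j) = d * w n)"
    and t: "0 \<le> t" "t \<le> L"
  shows "measure lborel (A \<inter> {0..<t}) = measure lborel (A \<inter> {0..<1}) * t"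
proof (rule ccontr)
  let ?F = "\<lambda>t. measure lborel (A \<inter> {0..<t})"
  assume "?F t \<noteq> ?F 1 * t"
  then have e: "\<bar>?F t - ?F 1 * t\<bar> > 0" by simp
  have "(\<lambda>n. rest n * (1 + t)) \<longlonglongrightarrow> 0"
    using tendsto_mult_right[OF rest_tendsto, of "1 + t"] by simp
  then have "eventually (\<lambda>n. rest n * (1 + t) < \<bar>?F t - ?F 1 * t\<bar>) sequentially"
    using e by (rule order_tendstoD)
  from frequently_ex[OF frequently_eventually_frequently[OF eq[unfolded cofinite_eq_sequentially] this]]
  obtain n where n: "n \<ge> 1" "rest n * (1 + t) < \<bar>?F t - ?F 1 * t\<bar>"
    and "\<exists>d. \<forall>j<h n. measure lborel (A \<inter> level r s n j) = d * w n"
    by blast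
  then obtain d where d: "\<And>j. j < h n \<Longrightarrow> measure lborel (A \<inter> level r s n j) = d * w n" by auto
  have "\<bar>?F t - d * t\<bar> \<le> rest n" "\<bar>?F 1 - d\<bar> \<le> rest n"
    using measure_approx[OF n(1) A d t] measure_approx[OF n(1) A d, of 1] L_ge_1 by auto
  moreover from this(2) have "\<bar>?F 1 * t - d * t\<bar> \<le> rest n * t"
    using t mult_right_mono[of "\<bar>?F 1 - d\<bar>" "rest n" t] by (simp add: left_diff_distrib[symmetric] abs_mult)
  ultimately show False using n(2) by (simp add: distrib_left)
qed

text \<open>Linearity makes the restriction \<open>M1\<close> of Lebesgue measure to
  \<open>A\<close> and the multiple \<open>M2\<close> by \<open>d\<close> agree on half-lines, hence
  everywhere. Evaluating both at \<open>A\<close> gives \<open>d * L = d * (d * L)\<close>, so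
  \<open>d\<close> is 0 or 1.\<close>

lemma uniform_levels_imp_trivial:
  assumes A: "A \<in> sets borel"
    and eq: "\<exists>\<^sub>\<infinity>n. n \<ge> 1 \<and> (\<exists>d. \<forall>j<h n. measure lborel (A \<inter> level r s n j) = d * w n)"
  shows "emeasure lborel (X \<inter> A) = 0 \<or> emeasure lborel (X - A) = 0"
proof -
  note [measurable] = A
  define d where "d = measure lborel (A \<inter> {0..<1})"
  have d: "0 \<le> d" by (simp add: d_def)
  have lin: "measure lborel (A \<inter> {0..<t}) = d * t" if "0 \<le> t" "t \<le> L" for t
    unfolding d_def by (rule measure_linear[OF A eq that])
  define M1 where "M1 = density lborel (indicator (A \<inter> X))"
  define M2 where "M2 = density lborel (\<lambda>x. ennreal d * indicator X x)"
  have M1: "emeasure M1 E = emeasure lborel (A \<inter> X \<inter> E)" if "E \<in> sets borel" for E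
    using that by (simp add: M1_def emeasure_density indicator_inter_arith[symmetric])
  have M2: "emeasure M2 E = ennreal d * emeasure lborel (X \<inter> E)" if "E \<in> sets borel" for E
    using that by (simp add: M2_def emeasure_density mult.assoc nn_integral_cmult indicator_inter_arith[symmetric])
  \<comment> \<open>The uniqueness theorem tests open half-lines, whereas \<open>lin\<close>
    concerns half-open intervals; they differ by a null point.\<close>
  have tail: "emeasure lborel (E \<inter> {t<..<L}) = ennreal (measure lborel (E \<inter> {t..<L}))"
    if "E \<in> sets borel" for E t
  proof -
    have "emeasure lborel (E \<inter> {t<..<L}) = emeasure lborel (E \<inter> {t..<L})"
      using that AE_lborel_singleton[of t] by (intro emeasure_eq_AE) auto
    then show ?thesis using emeasure_Int_interval by (simp add: emeasure_eq_ennreal_measure)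
  qed
  have fin: "emeasure lborel (E \<inter> {a..<b}) = ennreal (measure lborel (E \<inter> {a..<b}))" for E and a b :: real
    using emeasure_Int_interval by (intro emeasure_eq_ennreal_measure) simp
  have FL: "emeasure lborel (A \<inter> {0..<L}) = ennreal (d * L)"
    using lin[of L] L_ge_1 by (simp add: fin)
  have "M1 = M2"
  proof (rule measure_eqI_lessThan)
    fix t :: real
    show "emeasure M1 {t<..} < \<infinity>"
      using emeasure_Int_interval[of "A \<inter> {t<..}" 0 L] M1[of "{t<..}"]
      by (simp add: X_eq less_top Int_ac)
    consider "t < 0" | "0 \<le> t" "t \<le> L" | "L < t" by linarith
    then show "emeasure M1 {t<..} = emeasure M2 {t<..}"
    proof cases
      case 1
      then have "X \<inter> {t<..} = {0..<L}" by (auto simp: X_eq)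
      then show ?thesis using FL L_ge_1 d by (simp add: M1 M2 Int_assoc ennreal_mult)
    next
      case 2
      then have X: "X \<inter> {t<..} = {t<..<L}" by (auto simp: X_eq)
      have "measure lborel (A \<inter> {t..<L}) = d * (L - t)"
        using measure_interval_split[OF A 2] lin[of L] lin[of t] 2 L_ge_1 by (simp add: right_diff_distrib)
      then show ?thesis using d 2 tail[OF A, of t]
        by (simp add: M1 M2 Int_assoc X ennreal_mult)
    next
      case 3
      then have "X \<inter> {t<..} = {}" by (auto simp: X_eq)
      then show ?thesis by (simp add: M1 M2 Int_assoc)
    qed
  qed (auto simp: M1_def M2_def)
  then have "emeasure M1 A = emeasure M2 A" by simp
  moreover have FL: "emeasure lborel (X \<inter> A) = ennreal (d * L)"
    using FL by (simp add: X_eq Int_commute)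
  ultimately have "ennreal (d * L) = ennreal (d * (d * L))"
    using d L_ge_1 by (simp add: M1 M2 Int_ac ennreal_mult)
  then have "d * L = d * (d * L)" using d L_ge_1 by (simp add: ennreal_inj)
  then consider "d = 0" | "d = 1" using L_ge_1 by auto
  then show ?thesis
  proof cases
    case 2
    have "emeasure lborel (X - A) = emeasure lborel X - emeasure lborel (X \<inter> A)"
      using FL by (subst emeasure_Diff[symmetric]) (auto simp: Diff_Int)
    then show ?thesis using 2 FL L_ge_1 by (simp add: X_eq)
  qed (use FL in simp)
qed

section \<open>A criterion for total ergodicity\<close>

lemma copy_offset_inj: "inj (copy_offset r s n)"
  by (rule strict_mono_imp_inj_on[OF strict_monoI_Suc]) (simp add: copy_offset_def hgt_pos)

text \<open>For a \<open>T\<^sup>k\<close>-invariant set the measure inside a level depends only on the height of that level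
  modulo \<open>k\<close>. When the copies of column \<open>n\<close> inside column \<open>n + 1\<close> start at heights running
  uniformly through the residues modulo \<open>k\<close>, this dependence averages out.\<close>

lemma totally_ergodicI:
  assumes good: "\<And>k. k \<ge> 1 \<Longrightarrow>
    \<exists>\<^sub>\<infinity>n. n \<ge> 1 \<and> k dvd r n + 1 \<and> (\<forall>i\<le>r n. copy_offset r s n i mod k = i mod k)"
  shows "totally_ergodic (rmeas r s) T"
  unfolding totally_ergodic_def ergodic_map_def
proof (intro allI impI conjI ballI)
  fix k :: nat assume k: "k \<ge> 1"
  show "measure_preserving_map (rmeas r s) (T ^^ k)"
    by (rule measure_preserving_funpow[OF Tmap_measure_preserving])
  fix A assume "A \<in> sets (rmeas r s)" and "(T ^^ k) -` A \<inter> space (rmeas r s) = A"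
  then have A: "A \<in> sets borel" and inv: "(T ^^ k) -` A = A"
    by (auto simp: sets_rmeas space_rmeas)
  define a where "a n j = measure lborel (A \<inter> level r s n j)" for n j
  have em: "emeasure lborel (level r s n j \<inter> A) = ennreal (a n j)" for n j
    using emeasure_Int_interval[of A]
    by (simp add: a_def level_def Int_commute emeasure_eq_ennreal_measure)
  have step: "a n j = a n (j + k)" if "n \<ge> 1" "j + k < h n" for n j
    using emeasure_level_Tmap_funpow[OF that A] by (simp add: inv em a_def)
  have periodic: "a n j = a n (j mod k)" if "n \<ge> 1" "j < h n" for n j
    using that(2)
  proof (induction j rule: less_induct)
    case (less j)
    show ?case
    proof (cases "j < k")
      case False
      then show ?thesis
        using less.IH[of "j - k"] less.prems step[OF that(1), of "j - k"] k by (simp add: le_mod_geq)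
    qed simp
  qed
  \<comment> \<open>The right-hand side is free of \<open>j\<close>, so all levels of column
    \<open>n\<close> carry the same measure.\<close>
  have const: "a n j = (\<Sum>i<r n + 1. a (Suc n) (i mod k))"
    if n: "n \<ge> 1" "k dvd r n + 1" "\<forall>i\<le>r n. copy_offset r s n i mod k = i mod k" and j: "j < h n" for n j
  proof -
    let ?J = "(\<lambda>i. copy_offset r s n i + j) ` {..r n}"
    have "ennreal (a n j) = emeasure lborel ((\<Union>m\<in>?J. level r s (Suc n) m) \<inter> A)"
      unfolding em[symmetric] level_split[OF n(1) j] by simp
    also have "\<dots> = (\<Sum>m\<in>?J. emeasure lborel (level r s (Suc n) m \<inter> A))"
      using copy_offset_less[OF n(1) _ j] by (intro emeasure_Union_levels A) auto
    also have "\<dots> = (\<Sum>i\<le>r n. ennreal (a (Suc n) (copy_offset r s n i + j)))"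
      using copy_offset_inj[of n] by (subst sum.reindex) (auto simp: em inj_on_def)
    also have "\<dots> = ennreal (\<Sum>i\<le>r n. a (Suc n) (copy_offset r s n i + j))"
      by (rule sum_ennreal) (simp add: a_def)
    finally have "a n j = (\<Sum>i\<le>r n. a (Suc n) (copy_offset r s n i + j))"
      by (subst (asm) ennreal_inj) (auto simp: a_def intro: sum_nonneg)
    also have "\<dots> = (\<Sum>i\<le>r n. a (Suc n) ((i + j) mod k))"
    proof (rule sum.cong[OF refl])
      fix i assume "i \<in> {..r n}"
      then have i: "i \<le> r n" by simp
      have "(copy_offset r s n i + j) mod k = (i + j) mod k"
        using n(3) i by (metis mod_add_left_eq)
      then show "a (Suc n) (copy_offset r s n i + j) = a (Suc n) ((i + j) mod k)"
        using periodic[OF _ copy_offset_less[OF n(1) i j]] by simp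
    qed
    also have "\<dots> = (\<Sum>i<r n + 1. a (Suc n) (i mod k))"
      using sum_mod_shift[OF n(2), of "a (Suc n)" j] by (simp add: lessThan_Suc_atMost)
    finally show ?thesis .
  qed
  have "\<exists>\<^sub>\<infinity>n. n \<ge> 1 \<and> (\<exists>d. \<forall>j<h n. measure lborel (A \<inter> level r s n j) = d * w n)"
    using good[OF k]
  proof (rule INFM_mono)
    fix n assume n: "n \<ge> 1 \<and> k dvd r n + 1 \<and> (\<forall>i\<le>r n. copy_offset r s n i mod k = i mod k)"
    have "measure lborel (A \<inter> level r s n j) = a n 0 / w n * w n" if "j < h n" for j
    proof -
      have "a n j = a n 0" using const[of n j] const[of n 0] n that hgt_pos[of r s n] by auto
      then show ?thesis using wid_pos[of r n] by (simp add: a_def)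
    qed
    with n show "n \<ge> 1 \<and> (\<exists>d. \<forall>j<h n. measure lborel (A \<inter> level r s n j) = d * w n)" by blast
  qed
  from uniform_levels_imp_trivial[OF A this]
  show "emeasure (rmeas r s) A = 0 \<or> emeasure (rmeas r s) (space (rmeas r s) - A) = 0"
    using A by (auto simp: emeasure_rmeas space_rmeas Diff_eq Int_commute)
qed

end

section \<open>Total ergodicity and complexity of the alternating construction\<close>

context alternating begin

lemma copy_offset_alt:
  assumes "i \<le> r n"
  shows "copy_offset r (alt_spacers r) n i = i * (h n + gap n)"
proof -
  have "copy_offset r (alt_spacers r) n i = (\<Sum>i'<i. h n + gap n)"
    unfolding copy_offset_def using assms by (intro sum.cong) (auto simp: alt_spacers_def)
  then show ?thesis by simp
qed

text \<open>Including the width makes the induction close: at most \<open>r n\<close> spacers are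
  added, and \<open>r n\<close> new widths are exactly what the width loses.\<close>

lemma Lend_alt_le: "n \<ge> 1 \<Longrightarrow> Lend r (alt_spacers r) n + wid r n \<le> 2"
proof (induction n rule: dec_induct)
  case (step n)
  have "(\<Sum>i\<le>r n. alt_spacers r n i) \<le> r n"
    using gap_le_1[of n] by (simp add: lessThan_Suc_atMost[symmetric] alt_spacers_def)
  then have "real (\<Sum>i\<le>r n. alt_spacers r n i) * wid r (Suc n) \<le> real (r n) * wid r (Suc n)"
    using wid_pos[of r "Suc n"] by (intro mult_right_mono of_nat_mono) auto
  moreover have "wid r n = (real (r n) + 1) * wid r (Suc n)"
    using step.hyps by (simp add: wid_Suc add_pos_nonneg order.strict_implies_not_eq[symmetric])
  ultimately show ?case using step by (simp add: Lend_Suc distrib_right)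
qed (simp add: wid_def)

sublocale col: columns r "alt_spacers r"
proof
  have "Lend r (alt_spacers r) n \<le> 2" for n
    using Lend_alt_le[of n] wid_pos[of r n] by (cases n) auto
  then show "bdd_above (range (Lend r (alt_spacers r)))" by (intro bdd_aboveI2)
qed (rule r_pos)

lemma totally_ergodic_alt:
  assumes "\<And>n. n \<ge> 1 \<Longrightarrow> fact n dvd r n + 1"
  shows "totally_ergodic (rmeas r (alt_spacers r)) (Tmap r (alt_spacers r))"
proof (rule col.totally_ergodicI)
  fix k :: nat assume k: "k \<ge> 1"
  have dvd: "k dvd r n + 1" if "n \<ge> k" for n
    using assms[of n] dvd_fact[OF k that] k that by (meson dvd_trans order_trans)
  show "\<exists>\<^sub>\<infinity>n. n \<ge> 1 \<and> k dvd r n + 1 \<and> (\<forall>i\<le>r n. copy_offset r (alt_spacers r) n i mod k = i mod k)"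
    unfolding INFM_nat
  proof
    fix m
    \<comment> \<open>\<open>n\<close> is odd, so no spacers enter at stage \<open>n\<close> and
      \<open>h (Suc n)\<close> inherits the divisor \<open>k\<close> of \<open>r n + 1\<close>. The
      witness is the even index \<open>Suc n\<close>, whose gap 1 makes the offsets congruent to
      \<open>i\<close>.\<close>
    define n where "n = 2 * (m + k) + 1"
    have "h (Suc n) = (r n + 1) * h n" using h_Suc[of n] by (simp add: n_def gap_def)
    moreover have "k dvd r n + 1" by (rule dvd) (simp add: n_def)
    ultimately have "k dvd h (Suc n)" by (metis dvd_mult2)
    then obtain c where c: "h (Suc n) = k * c" by blast
    have "gap (Suc n) = 1" by (simp add: n_def gap_def)
    then have "i * (h (Suc n) + gap (Suc n)) = i + k * (i * c)" for i
      by (simp add: c algebra_simps)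
    then have "(i * (h (Suc n) + gap (Suc n))) mod k = i mod k" for i
      by simp
    then show "\<exists>n>m. n \<ge> 1 \<and> k dvd r n + 1 \<and>
        (\<forall>i\<le>r n. copy_offset r (alt_spacers r) n i mod k = i mod k)"
      using dvd[of "Suc n"] by (intro exI[of _ "Suc n"]) (auto simp: n_def copy_offset_alt)
  qed
qed

lemma h_ge: "n \<ge> 1 \<Longrightarrow> h n \<ge> n"
proof (induction n rule: dec_induct)
  case (step n)
  then show ?case using h_double[of n] by linarith
qed (simp add: h_1)

text \<open>Take \<open>h n \<le> q < h (Suc n)\<close> with \<open>n = Suc m\<close>. Up to
  \<open>2 * h n\<close> the bound \<open>2 * q - h n + h m\<close> is at most
  \<open>1.5 * q + h m\<close>; beyond that, \<open>q + h n\<close> is below \<open>1.5 * q\<close>.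
  At \<open>q = h n\<close> the bound one level down gives \<open>q + h m\<close>.\<close>

lemma complexity_less:
  fixes f :: "nat \<Rightarrow> real"
  assumes f: "\<And>n q. n \<ge> 1 \<Longrightarrow> q \<ge> h (Suc n) \<Longrightarrow> f q > real (h n)"
  shows "q \<ge> h 2 \<Longrightarrow> real (complexity r (alt_spacers r) q) < 1.5 * real q + f q"
    and "n \<ge> 2 \<Longrightarrow> real (complexity r (alt_spacers r) (h n)) < real (h n) + f (h n)"
proof -
  show *: "real (complexity r (alt_spacers r) (h n)) < real (h n) + f (h n)" if n: "n \<ge> 2" for n
  proof -
    obtain m where m: "n = Suc m" "m \<ge> 1" using n by (cases n) auto
    show ?thesis using complexity_le[OF m(2), of "h n"] f[OF m(2), of "h n"] h_pos[of n] m by simp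
  qed
  assume q: "q \<ge> h 2"
  define n where "n = (LEAST n. q < h (Suc n))"
  have "\<exists>n. q < h (Suc n)" using h_ge[of "Suc q"] by (intro exI[of _ q]) simp
  then have n: "q < h (Suc n)" unfolding n_def by (rule LeastI_ex)
  have "n \<noteq> 0" using n q h_double[of 1] by (cases n) (auto simp: numeral_2_eq_2)
  moreover have "n \<noteq> 1" using n q by (auto simp: numeral_2_eq_2)
  ultimately obtain m where m: "n = Suc m" "m \<ge> 1" by (cases n) auto
  have "m < n" using m by simp
  then have hq: "h n \<le> q" using not_less_Least[of m "\<lambda>n. q < h (Suc n)"] by (simp add: n_def[symmetric] m)
  have fq: "f q > real (h m)" using f[OF m(2), of q] hq m by simp
  consider "q = h n" | "h n < q" "q \<le> 2 * h n" | "2 * h n < q" using hq by linarith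
  then show "real (complexity r (alt_spacers r) q) < 1.5 * real q + f q"
  proof cases
    case 1
    then show ?thesis using *[of n] m by simp
  next
    case 2
    then show ?thesis using complexity_le_double[OF m(2), of q] m fq by simp
  next
    case 3
    then show ?thesis using complexity_le[of n q] n m fq by simp
  qed
qed

end

section \<open>Choice of the cut sequence\<close>

lemma exists_cuts:
  assumes "\<And>n x. R n x \<ge> 1"
  shows "\<exists>r. alternating r \<and> (\<forall>n\<ge>1. r n = R n (hgt r (alt_spacers r) n))"
proof -
  \<comment> \<open>The cut \<open>r n\<close> is to depend on \<open>h n\<close>, which depends on
    the earlier cuts. \<open>K\<close> runs the height recursion with the cuts already substituted,
    starting from index 0 for \<open>h 1\<close>, and \<open>r\<close> is read off from it.\<close>
  define K where "K = rec_nat 1 (\<lambda>m x. (R (Suc m) x + 1) * x + R (Suc m) x * gap (Suc m))"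
  define r where "r n = R n (K (n - 1))" for n
  interpret alternating r by unfold_locales (unfold r_def, rule assms)
  have K: "K 0 = 1" "K (Suc m) = (R (Suc m) (K m) + 1) * K m + R (Suc m) (K m) * gap (Suc m)" for m
    by (simp_all add: K_def)
  have r_Suc: "r (Suc m) = R (Suc m) (K m)" for m by (simp add: r_def)
  have "h (Suc m) = K m" for m
    by (induction m) (simp_all add: h_1 h_Suc K r_Suc)
  then have "r n = R n (h n)" if "n \<ge> 1" for n using that by (cases n) (auto simp: r_Suc)
  then show ?thesis using alternating_axioms by blast
qed

theorem theorem5:
  fixes f :: "nat \<Rightarrow> real"
  assumes "filterlim f at_top sequentially"
  shows "\<exists>(r :: nat \<Rightarrow> nat) (s :: nat \<Rightarrow> nat \<Rightarrow> nat).
           (\<forall>n\<ge>1. r n \<ge> 1) \<and>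
           emeasure lborel (rspace r s) < \<infinity> \<and>
           totally_ergodic (rmeas r s) (Tmap r s) \<and>
           (\<exists>Q. \<forall>q\<ge>Q. real (complexity r s q) < 1.5 * real q + f q) \<and>
           (\<forall>n\<ge>2. real (complexity r s (hgt r s n)) < real (hgt r s n) + f (hgt r s n))"
proof -
  have "\<exists>N. \<forall>q\<ge>N. f q > real x" for x :: nat
    using assms by (simp add: filterlim_at_top_dense eventually_sequentially)
  then obtain N where N: "\<And>x q. q \<ge> N x \<Longrightarrow> f q > real x" by metis
  \<comment> \<open>The factorial provides the divisibility for total ergodicity, and
    \<open>N x\<close> makes the next height pass the threshold after which \<open>f\<close> exceeds
    \<open>x = h n\<close>. The summand 2 keeps the cut at least 1 even when
    \<open>N x = 0\<close>.\<close>
  define R where "R n x = fact n * (N x + 2) - 1" for n x :: nat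
  have R: "R n x + 1 = fact n * (N x + 2)" for n x by (simp add: R_def)
  have "N x + 2 \<le> fact n * (N x + 2)" for n x :: nat
    using mult_le_mono1[of 1 "fact n" "N x + 2"] fact_ge_1[of n] by simp
  then have R_ge: "R n x \<ge> N x + 1" for n x
    using R[of n x] by (metis Suc_eq_plus1 Suc_le_mono add_2_eq_Suc')
  obtain r where r: "alternating r" "\<And>n. n \<ge> 1 \<Longrightarrow> r n = R n (hgt r (alt_spacers r) n)"
    using exists_cuts[of R] R_ge by (meson add_leD2)
  interpret alternating r by (rule r(1))
  have f: "f q > real (h n)" if n: "n \<ge> 1" and q: "q \<ge> h (Suc n)" for n q
  proof (rule N)
    have "N (h n) \<le> r n + 1" using R_ge[of "h n" n] r(2)[OF n] by simp
    also have "\<dots> \<le> (r n + 1) * h n" using mult_le_mono2[OF h_pos[OF n], of "r n + 1"] by simp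
    also have "\<dots> \<le> q" using q h_Suc[OF n] by simp
    finally show "N (h n) \<le> q" .
  qed
  show ?thesis
  proof (intro exI conjI allI impI)
    show "emeasure lborel (rspace r (alt_spacers r)) < \<infinity>" using col.L_ge_1 by (simp add: col.X_eq)
    show "totally_ergodic (rmeas r (alt_spacers r)) (Tmap r (alt_spacers r))"
      using r(2) R by (intro totally_ergodic_alt) auto
  qed (use r_pos complexity_less[OF f] in auto)
qed

end
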